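(* Let a labelled triangle shape be chosen at random according to the uniform distribution (normalized area measure) on the shape sphere $\mathbb{S}^2$ of labelled planar triangles. Then $$\mathrm{Prob}(\text{obtuse}) = \frac{3}{4},$$ and, complementarily, $\mathrm{Prob}(\text{acute}) = 1 - \mathrm{Prob}(\text{obtuse}) = \frac{1}{4}$.
   Context: A labelled triangle is an ordered triple $(q_1,q_2,q_3)$ of points of $\mathbb{R}^2$, not all three equal. Its shape is its equivalence class under translations, rotations and positive dilations (vertices are labelled; mirror images are not identified). Relative Jacobi coordinates: $R_1 = q_3 - q_2$ and $R_2 = q_1 - \tfrac12(q_2+q_3)$. Mass-weighted relative Jacobi coordinates: $\vec\rho_1 = \sqrt{1/2}\,R_1$ and $\vec\rho_2 = \sqrt{2/3}\,R_2$, with magnitudes $\rho_1,\rho_2$. The shape sphere is the unit sphere $\mathbb{S}^2\subset\mathbb{R}^3$ with its standard round metric. Shapes are identified with its points by the bijection sending the shape of $(q_1,q_2,q_3)$ to $$(X,Y,Z) = \frac{\left(2\,\vec\rho_1\cdot\vec\rho_2,\; 2(\vec\rho_1\times\vec\rho_2)_3,\; \rho_1^2-\rho_2^2\right)}{\rho_1^2+\rho_2^2},$$ where $(\vec a\times\vec b)_3 = a_1b_2-a_2b_1$. The uniform distribution on the shape sphere is surface area measure divided by $4\pi$. A non-collinear triangle is obtuse if one of its interior angles is strictly greater than $\pi/2$, and acute if all its interior angles are strictly less than $\pi/2$. Collinear shapes and right-angled shapes form null sets. $\mathrm{Prob}(P)$ denotes the probability of the set of shapes having property $P$. *)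

theory Defs
  imports "HOL-Probability.Probability"
begin

type_synonym point = "real^2"
type_synonym triangle = "point \<times> point \<times> point"

definition triangles :: "triangle set" where
  "triangles = {(q1, q2, q3). \<not> (q1 = q2 \<and> q2 = q3)}"

definition shape_rel :: "(triangle \<times> triangle) set" where
  "shape_rel = {((p1, p2, p3), (q1, q2, q3)).
     (p1, p2, p3) \<in> triangles \<and> (q1, q2, q3) \<in> triangles \<and>
     (\<exists>(A :: real^2^2) c b. orthogonal_matrix A \<and> det A = 1 \<and> 0 < c \<and>
        q1 = c *\<^sub>R (A *v p1) + b \<and> q2 = c *\<^sub>R (A *v p2) + b \<and> q3 = c *\<^sub>R (A *v p3) + b)}"

definition shapes :: "triangle set set" where
  "shapes = triangles // shape_rel"

fun jacobi1 :: "triangle \<Rightarrow> point" where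
  "jacobi1 (q1, q2, q3) = q3 - q2"

fun jacobi2 :: "triangle \<Rightarrow> point" where
  "jacobi2 (q1, q2, q3) = q1 - (1/2) *\<^sub>R (q2 + q3)"

definition rho1 :: "triangle \<Rightarrow> point" where
  "rho1 q = sqrt (1/2) *\<^sub>R jacobi1 q"

definition rho2 :: "triangle \<Rightarrow> point" where
  "rho2 q = sqrt (2/3) *\<^sub>R jacobi2 q"

definition cross2 :: "point \<Rightarrow> point \<Rightarrow> real" where
  "cross2 a b = a $ 1 * b $ 2 - a $ 2 * b $ 1"

definition triangle_point :: "triangle \<Rightarrow> real^3" where
  "triangle_point q = (1 / ((norm (rho1 q))\<^sup>2 + (norm (rho2 q))\<^sup>2)) *\<^sub>R
     vector [2 * (rho1 q \<bullet> rho2 q), 2 * cross2 (rho1 q) (rho2 q),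
             (norm (rho1 q))\<^sup>2 - (norm (rho2 q))\<^sup>2]"

text \<open>The common value of \<^const>\<open>triangle_point\<close> on all representatives of a shape; that it does
  not depend on the representative is \<open>shape_point_class\<close> below.\<close>

definition shape_point :: "triangle set \<Rightarrow> real^3" where
  "shape_point S = the_elem (triangle_point ` S)"

text \<open>Surface area of a parametrised surface in space: the push-forward of
  \<open>\<parallel>\<partial>\<^sub>uF \<times> \<partial>\<^sub>vF\<parallel> du dv\<close>. The parameter domain \<open>D\<close> must be one on which the parametrisation
  is injective up to a null set.\<close>

definition area_element :: "(real \<Rightarrow> real \<Rightarrow> real^3) \<Rightarrow> real \<Rightarrow> real \<Rightarrow> real" where
  "area_element F u v =
     norm (cross3 (vector_derivative (\<lambda>s. F s v) (at u)) (vector_derivative (\<lambda>t. F u t) (at v)))"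

definition surface_area :: "(real \<times> real) set \<Rightarrow> (real \<Rightarrow> real \<Rightarrow> real^3) \<Rightarrow> (real^3) set \<Rightarrow> (real^3) measure" where
  "surface_area D F S =
     distr (density (restrict_space lborel D) (\<lambda>(u, v). ennreal (area_element F u v)))
       (restrict_space borel S) (\<lambda>(u, v). F u v)"

text \<open>Spherical coordinates (polar angle, azimuth) about the \<open>Y\<close>-axis, whose poles are the two
  equilateral shapes and whose equator \<open>Y = 0\<close> consists of the collinear shapes. The area measure
  does not depend on the choice of axis.\<close>

definition spherical :: "real \<Rightarrow> real \<Rightarrow> real^3" where
  "spherical u v = vector [sin u * sin v, cos u, sin u * cos v]"

definition sphere_area :: "(real^3) measure" where
  "sphere_area = surface_area ({0..pi} \<times> {0..<2 * pi}) spherical (sphere 0 1)"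

definition sphere_uniform :: "(real^3) measure" where
  "sphere_uniform = scale_measure (ennreal (1 / (4 * pi))) sphere_area"

text \<open>A property of triangles is regarded as a property of shapes; the properties used here are
  invariant under similarities, see \<open>obtuse_invariant\<close> and \<open>acute_invariant\<close>.\<close>

definition shape_prob :: "(triangle \<Rightarrow> bool) \<Rightarrow> real" where
  "shape_prob P = measure sphere_uniform (shape_point ` {S \<in> shapes. \<forall>q\<in>S. P q})"

definition angle_at :: "point \<Rightarrow> point \<Rightarrow> point \<Rightarrow> real" where
  "angle_at a b c = arccos ((b - a) \<bullet> (c - a) / (norm (b - a) * norm (c - a)))"

fun interior_angles :: "triangle \<Rightarrow> real set" where
  "interior_angles (q1, q2, q3) = {angle_at q1 q2 q3, angle_at q2 q3 q1, angle_at q3 q1 q2}"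

fun collinear_triangle :: "triangle \<Rightarrow> bool" where
  "collinear_triangle (q1, q2, q3) \<longleftrightarrow> collinear {q1, q2, q3}"

definition obtuse :: "triangle \<Rightarrow> bool" where
  "obtuse q \<longleftrightarrow> \<not> collinear_triangle q \<and> (\<exists>\<alpha>\<in>interior_angles q. \<alpha> > pi / 2)"

definition acute :: "triangle \<Rightarrow> bool" where
  "acute q \<longleftrightarrow> \<not> collinear_triangle q \<and> (\<forall>\<alpha>\<in>interior_angles q. \<alpha> < pi / 2)"

subsection \<open>Well-definedness\<close>

definition similarity :: "real \<Rightarrow> real \<Rightarrow> point \<Rightarrow> point" where
  "similarity a b x = vector [a * x$1 - b * x$2, b * x$1 + a * x$2]"

lemma point_eq_iff: "x = y \<longleftrightarrow> x$1 = y$1 \<and> x$2 = y$2" for x y :: point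
  by (simp add: vec_eq_iff forall_2)

lemma similarity_nth [simp]:
  "similarity a b x $ 1 = a * x$1 - b * x$2" "similarity a b x $ 2 = b * x$1 + a * x$2"
  by (simp_all add: similarity_def)

lemma rotation_form:
  fixes A :: "real^2^2"
  assumes "orthogonal_matrix A" "det A = 1"
  shows "A$2$2 = A$1$1" "A$1$2 = - A$2$1" "(A$1$1)\<^sup>2 + (A$2$1)\<^sup>2 = 1"
proof -
  have m: "(A ** transpose A)$i$j = (mat 1 :: real^2^2)$i$j"
    "(transpose A ** A)$i$j = (mat 1 :: real^2^2)$i$j" for i j
    using assms(1) by (simp_all add: orthogonal_matrix_def)
  have 1: "A$1$1 * A$1$1 + A$2$1 * A$2$1 = 1" "A$1$2 * A$1$2 + A$2$2 * A$2$2 = 1"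
    using m(2)[of 1 1] m(2)[of 2 2]
    by (simp_all add: matrix_matrix_mult_def transpose_def mat_def sum_2)
  have 2: "A$1$1 * A$2$2 - A$1$2 * A$2$1 = 1"
    using assms(2) by (simp add: det_2)
  have "(A$2$2 - A$1$1)\<^sup>2 + (A$1$2 + A$2$1)\<^sup>2 = 0"
    using 1 2 by (simp add: power2_eq_square algebra_simps)
  then show "A$2$2 = A$1$1" "A$1$2 = - A$2$1"
    by (auto simp: sum_power2_eq_zero_iff)
  show "(A$1$1)\<^sup>2 + (A$2$1)\<^sup>2 = 1"
    using 1 by (simp add: power2_eq_square)
qed

lemma shape_rel_iff:
  "((p1, p2, p3), (q1, q2, q3)) \<in> shape_rel \<longleftrightarrow>
     (p1, p2, p3) \<in> triangles \<and> (q1, q2, q3) \<in> triangles \<and>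
     (\<exists>a b t. a\<^sup>2 + b\<^sup>2 \<noteq> 0 \<and> q1 = similarity a b p1 + t \<and> q2 = similarity a b p2 + t \<and>
        q3 = similarity a b p3 + t)"
proof -
  have "\<exists>a b. a\<^sup>2 + b\<^sup>2 \<noteq> 0 \<and> (\<forall>x. c *\<^sub>R (A *v x) = similarity a b x)"
    if "orthogonal_matrix A" "det A = 1" "0 < c" for A :: "real^2^2" and c
  proof (intro exI conjI allI)
    note r = rotation_form[OF that(1,2)]
    have "(c * A$1$1)\<^sup>2 + (c * A$2$1)\<^sup>2 = c\<^sup>2 * ((A$1$1)\<^sup>2 + (A$2$1)\<^sup>2)"
      by (simp add: power_mult_distrib distrib_left)
    then show "(c * A$1$1)\<^sup>2 + (c * A$2$1)\<^sup>2 \<noteq> 0"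
      using r(3) that(3) by simp
    show "c *\<^sub>R (A *v x) = similarity (c * A$1$1) (c * A$2$1) x" for x
      using r by (simp add: point_eq_iff matrix_vector_mult_def sum_2 algebra_simps)
  qed
  moreover have "\<exists>(A :: real^2^2) c. orthogonal_matrix A \<and> det A = 1 \<and> 0 < c \<and>
      (\<forall>x. similarity a b x = c *\<^sub>R (A *v x))" if "a\<^sup>2 + b\<^sup>2 \<noteq> 0" for a b
  proof -
    define c where "c = sqrt (a\<^sup>2 + b\<^sup>2)"
    have c: "c > 0" "c\<^sup>2 = a\<^sup>2 + b\<^sup>2"
      using that sum_power2_ge_zero[of a b] unfolding c_def
      by (simp_all add: less_le del: sum_power2_eq_zero_iff)
    define A :: "real^2^2" where "A = vector [vector [a/c, -b/c], vector [b/c, a/c]]"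
    have n: "A$1$1 = a/c" "A$1$2 = -b/c" "A$2$1 = b/c" "A$2$2 = a/c"
      by (simp_all add: A_def)
    have u: "a/c * (a/c) + b/c * (b/c) = 1"
    proof -
      have "a/c * (a/c) + b/c * (b/c) = (a\<^sup>2 + b\<^sup>2) / c\<^sup>2"
        by (simp add: power2_eq_square add_divide_distrib)
      then show ?thesis using c(1) by (simp flip: c(2))
    qed
    have "orthogonal_matrix A"
      unfolding orthogonal_matrix using u
      by (simp add: vec_eq_iff forall_2 matrix_matrix_mult_def transpose_def mat_def sum_2 n
          algebra_simps)
    moreover have "det A = 1"
      using u by (simp add: det_2 n)
    moreover have "similarity a b x = c *\<^sub>R (A *v x)" for x
      using c(1) by (simp add: point_eq_iff matrix_vector_mult_def sum_2 n distrib_left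
          right_diff_distrib)
    ultimately show ?thesis using c(1) by blast
  qed
  ultimately show ?thesis
    unfolding shape_rel_def by (simp only: mem_Collect_eq prod.case) metis
qed

lemma equiv_shape_rel: "equiv triangles shape_rel"
proof (rule equivI)
  show "shape_rel \<subseteq> triangles \<times> triangles"
    by (auto simp: shape_rel_def)
  show "refl_on triangles shape_rel"
  proof (rule refl_onI)
    fix p assume p: "p \<in> triangles"
    obtain p1 p2 p3 where [simp]: "p = (p1, p2, p3)" by (cases p)
    have "similarity 1 0 x + 0 = x" for x by (simp add: point_eq_iff)
    then have "\<exists>a b t. a\<^sup>2 + b\<^sup>2 \<noteq> 0 \<and> p1 = similarity a b p1 + t \<and> p2 = similarity a b p2 + t \<and>
        p3 = similarity a b p3 + t"
      by (intro exI[of _ 1] exI[of _ 0]) simp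
    with p show "(p, p) \<in> shape_rel" by (simp add: shape_rel_iff)
  qed
  show "sym shape_rel"
  proof (rule symI)
    fix p q assume pq: "(p, q) \<in> shape_rel"
    obtain p1 p2 p3 q1 q2 q3 where [simp]: "p = (p1, p2, p3)" "q = (q1, q2, q3)"
      by (cases p, cases q)
    from pq obtain a b t where h: "p \<in> triangles" "q \<in> triangles" "a\<^sup>2 + b\<^sup>2 \<noteq> 0"
      "q1 = similarity a b p1 + t" "q2 = similarity a b p2 + t" "q3 = similarity a b p3 + t"
      by (auto simp: shape_rel_iff)
    define d where "d = a\<^sup>2 + b\<^sup>2"
    have d: "d \<noteq> 0" "a * a + b * b = d" using h by (auto simp: d_def power2_eq_square)
    have "similarity (a/d) (-b/d) (similarity a b x + t) + - similarity (a/d) (-b/d) t = x" for x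
    proof -
      have "a/d * (a * s) + b/d * (b * s) = s" for s
      proof -
        have "a/d * (a * s) + b/d * (b * s) = (a * a + b * b) * s / d"
          by (simp add: add_divide_distrib algebra_simps)
        then show ?thesis using d by simp
      qed
      from this[of "x$1"] this[of "x$2"] show ?thesis
        by (simp add: point_eq_iff algebra_simps)
    qed
    moreover have "(a/d)\<^sup>2 + (-b/d)\<^sup>2 \<noteq> 0"
      using h(3) d(1) by (auto simp: sum_power2_eq_zero_iff)
    ultimately have "\<exists>a b t. a\<^sup>2 + b\<^sup>2 \<noteq> 0 \<and> p1 = similarity a b q1 + t \<and>
        p2 = similarity a b q2 + t \<and> p3 = similarity a b q3 + t"
      unfolding h(4-6) by metis
    with h(1,2) show "(q, p) \<in> shape_rel" by (simp add: shape_rel_iff)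
  qed
  show "trans shape_rel"
  proof (rule transI)
    fix p q r assume pqr: "(p, q) \<in> shape_rel" "(q, r) \<in> shape_rel"
    obtain p1 p2 p3 q1 q2 q3 r1 r2 r3
      where [simp]: "p = (p1, p2, p3)" "q = (q1, q2, q3)" "r = (r1, r2, r3)"
      by (cases p, cases q, cases r)
    from pqr(1) obtain a b t where h: "p \<in> triangles" "a\<^sup>2 + b\<^sup>2 \<noteq> 0"
      "q1 = similarity a b p1 + t" "q2 = similarity a b p2 + t" "q3 = similarity a b p3 + t"
      by (auto simp: shape_rel_iff)
    from pqr(2) obtain a' b' t' where h': "r \<in> triangles" "a'\<^sup>2 + b'\<^sup>2 \<noteq> 0"
      "r1 = similarity a' b' q1 + t'" "r2 = similarity a' b' q2 + t'" "r3 = similarity a' b' q3 + t'"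
      by (auto simp: shape_rel_iff)
    have "similarity a' b' (similarity a b x + t) + t' =
        similarity (a' * a - b' * b) (a' * b + b' * a) x + (similarity a' b' t + t')" for x
      by (simp add: point_eq_iff algebra_simps)
    moreover have "(a' * a - b' * b)\<^sup>2 + (a' * b + b' * a)\<^sup>2 = (a\<^sup>2 + b\<^sup>2) * (a'\<^sup>2 + b'\<^sup>2)"
      by (simp add: power2_eq_square algebra_simps)
    then have "(a' * a - b' * b)\<^sup>2 + (a' * b + b' * a)\<^sup>2 \<noteq> 0"
      using h(2) h'(2) by (metis mult_eq_0_iff)
    ultimately have "\<exists>a b t. a\<^sup>2 + b\<^sup>2 \<noteq> 0 \<and> r1 = similarity a b p1 + t \<and>
        r2 = similarity a b p2 + t \<and> r3 = similarity a b p3 + t"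
      unfolding h(3-5) h'(3-5) by metis
    with h(1) h'(1) show "(p, r) \<in> shape_rel" by (simp add: shape_rel_iff)
  qed
qed

lemma rho_similarity:
  assumes "q1 = similarity a b p1 + t" "q2 = similarity a b p2 + t" "q3 = similarity a b p3 + t"
  shows "rho1 (q1, q2, q3) = similarity a b (rho1 (p1, p2, p3))"
    and "rho2 (q1, q2, q3) = similarity a b (rho2 (p1, p2, p3))"
  by (simp_all add: assms rho1_def rho2_def point_eq_iff algebra_simps)

lemma inner_point: "x \<bullet> y = x$1 * y$1 + x$2 * y$2" for x y :: point
  by (simp add: inner_vec_def sum_2)

lemma inner_similarity: "similarity a b x \<bullet> similarity a b y = (a\<^sup>2 + b\<^sup>2) * (x \<bullet> y)"
  by (simp add: inner_point power2_eq_square algebra_simps)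

lemma cross2_similarity: "cross2 (similarity a b x) (similarity a b y) = (a\<^sup>2 + b\<^sup>2) * cross2 x y"
  by (simp add: cross2_def power2_eq_square algebra_simps)

lemma norm_similarity: "norm (similarity a b x) = sqrt (a\<^sup>2 + b\<^sup>2) * norm x"
  by (simp add: norm_eq_sqrt_inner inner_similarity real_sqrt_mult)

lemma triangle_point_nth:
  "triangle_point q $ 1 = 2 * (rho1 q \<bullet> rho2 q) / (rho1 q \<bullet> rho1 q + rho2 q \<bullet> rho2 q)"
  "triangle_point q $ 2 = 2 * cross2 (rho1 q) (rho2 q) / (rho1 q \<bullet> rho1 q + rho2 q \<bullet> rho2 q)"
  "triangle_point q $ 3 =
     (rho1 q \<bullet> rho1 q - rho2 q \<bullet> rho2 q) / (rho1 q \<bullet> rho1 q + rho2 q \<bullet> rho2 q)"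
  by (simp_all add: triangle_point_def power2_norm_eq_inner)

lemma triangle_point_invariant:
  assumes "(p, q) \<in> shape_rel"
  shows "triangle_point p = triangle_point q"
proof -
  obtain p1 p2 p3 q1 q2 q3 where [simp]: "p = (p1, p2, p3)" "q = (q1, q2, q3)"
    by (cases p, cases q)
  from assms obtain a b t where h: "a\<^sup>2 + b\<^sup>2 \<noteq> 0"
    "q1 = similarity a b p1 + t" "q2 = similarity a b p2 + t" "q3 = similarity a b p3 + t"
    by (auto simp: shape_rel_iff)
  define k where "k = a\<^sup>2 + b\<^sup>2"
  have k: "k \<noteq> 0" using h(1) by (simp add: k_def)
  have [simp]: "2 * (k * r) / (k * s + k * s') = 2 * r / (s + s')"
    "(k * r - k * r') / (k * s + k * s') = (r - r') / (s + s')" for r r' s s'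
    using k by (simp_all flip: distrib_left right_diff_distrib add: mult.left_commute[of 2])
  show ?thesis
    using rho_similarity[OF h(2-4)] unfolding vec_eq_iff[where 'b = 3] forall_3
    by (simp add: triangle_point_nth inner_similarity cross2_similarity flip: k_def)
qed

lemma shape_point_class:
  assumes "q \<in> triangles"
  shows "shape_point (shape_rel `` {q}) = triangle_point q"
proof -
  have "q \<in> shape_rel `` {q}"
    using equiv_class_self[OF equiv_shape_rel assms] .
  moreover have "triangle_point p = triangle_point q" if "p \<in> shape_rel `` {q}" for p
    using triangle_point_invariant that by fastforce
  ultimately have "triangle_point ` (shape_rel `` {q}) = {triangle_point q}"
    by blast
  then show ?thesis by (simp add: shape_point_def)
qed

lemma angle_at_similarity:
  assumes "a\<^sup>2 + b\<^sup>2 \<noteq> 0"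
  shows "angle_at (similarity a b x + t) (similarity a b y + t) (similarity a b z + t) = angle_at x y z"
proof -
  have d: "similarity a b y - similarity a b x = similarity a b (y - x)" for x y
    by (simp add: point_eq_iff algebra_simps)
  have "sqrt (a\<^sup>2 + b\<^sup>2) * r * (sqrt (a\<^sup>2 + b\<^sup>2) * s) = (a\<^sup>2 + b\<^sup>2) * (r * s)" for r s
  proof -
    have "sqrt (a\<^sup>2 + b\<^sup>2) * r * (sqrt (a\<^sup>2 + b\<^sup>2) * s) = (sqrt (a\<^sup>2 + b\<^sup>2))\<^sup>2 * (r * s)"
      by (simp only: power2_eq_square mult_ac)
    then show ?thesis by simp
  qed
  then show ?thesis
    using assms unfolding angle_at_def add_diff_cancel_right d inner_similarity norm_similarity
    by (simp only: mult_divide_mult_cancel_left not_False_eq_True)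
qed

lemma collinear_iff_cross2: "collinear {x, y, z} \<longleftrightarrow> cross2 (x - y) (z - y) = 0"
proof -
  have "collinear {x, y, z} \<longleftrightarrow> collinear {0, x - y, z - y}"
    by (rule collinear_3[unfolded NO_MATCH_def]) simp
  also have "\<dots> \<longleftrightarrow> cross2 (x - y) (z - y) = 0" (is "collinear {0, ?u, ?v} \<longleftrightarrow> _")
  proof -
    have "(?u \<bullet> ?v)\<^sup>2 + (cross2 ?u ?v)\<^sup>2 = (?u \<bullet> ?u) * (?v \<bullet> ?v)"
      by (simp add: inner_point cross2_def power2_eq_square algebra_simps)
    moreover have "\<bar>?u \<bullet> ?v\<bar> = norm ?u * norm ?v \<longleftrightarrow> (?u \<bullet> ?v)\<^sup>2 = (?u \<bullet> ?u) * (?v \<bullet> ?v)"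
    proof -
      have "\<bar>?u \<bullet> ?v\<bar> = norm ?u * norm ?v \<longleftrightarrow> \<bar>?u \<bullet> ?v\<bar>\<^sup>2 = (norm ?u * norm ?v)\<^sup>2"
        by (rule power2_eq_iff_nonneg[symmetric]) simp_all
      then show ?thesis
        by (simp add: power_mult_distrib power2_norm_eq_inner)
    qed
    ultimately show ?thesis
      by (auto simp flip: norm_cauchy_schwarz_equal)
  qed
  finally show ?thesis .
qed

lemma similar_properties:
  assumes "(p, q) \<in> shape_rel"
  shows "interior_angles p = interior_angles q" "collinear_triangle p \<longleftrightarrow> collinear_triangle q"
proof -
  obtain p1 p2 p3 q1 q2 q3 where [simp]: "p = (p1, p2, p3)" "q = (q1, q2, q3)"
    by (cases p, cases q)
  from assms obtain a b t where h: "a\<^sup>2 + b\<^sup>2 \<noteq> 0"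
    "q1 = similarity a b p1 + t" "q2 = similarity a b p2 + t" "q3 = similarity a b p3 + t"
    by (auto simp: shape_rel_iff)
  show "interior_angles p = interior_angles q"
    using h by (simp add: angle_at_similarity)
  have d: "similarity a b y - similarity a b x = similarity a b (y - x)" for x y
    by (simp add: point_eq_iff algebra_simps)
  show "collinear_triangle p \<longleftrightarrow> collinear_triangle q"
    using h by (auto simp: collinear_iff_cross2 d cross2_similarity)
qed

lemma obtuse_invariant: "(p, q) \<in> shape_rel \<Longrightarrow> obtuse p \<longleftrightarrow> obtuse q"
  by (simp add: obtuse_def similar_properties)

lemma acute_invariant: "(p, q) \<in> shape_rel \<Longrightarrow> acute p \<longleftrightarrow> acute q"
  by (simp add: acute_def similar_properties)


lemma rho_nonzero:
  assumes "q \<in> triangles"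
  shows "rho1 q \<bullet> rho1 q + rho2 q \<bullet> rho2 q > 0"
proof -
  obtain q1 q2 q3 where [simp]: "q = (q1, q2, q3)" by (cases q)
  have "rho1 q \<noteq> 0 \<or> rho2 q \<noteq> 0"
  proof (rule ccontr)
    assume "\<not> ?thesis"
    then have "q3 = q2" "q1 = (1/2) *\<^sub>R (q2 + q2)"
      by (auto simp: rho1_def rho2_def)
    with assms show False by (simp add: triangles_def flip: scaleR_2)
  qed
  then show ?thesis
    using inner_ge_zero[of "rho1 q"] inner_ge_zero[of "rho2 q"]
      inner_gt_zero_iff[of "rho1 q"] inner_gt_zero_iff[of "rho2 q"] by linarith
qed

lemma triangle_of_rho:
  assumes "u \<noteq> 0 \<or> v \<noteq> 0"
  obtains q where "q \<in> triangles" "rho1 q = u" "rho2 q = v"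
proof
  define s :: real and t :: real where "s = sqrt (1/2)" and "t = sqrt (2/3)"
  have st: "s \<noteq> 0" "t \<noteq> 0" by (simp_all add: s_def t_def)
  let ?q = "((1/t) *\<^sub>R v, (-1/(2 * s)) *\<^sub>R u, (1/(2 * s)) *\<^sub>R u)"
  show 1: "rho1 ?q = u" and 2: "rho2 ?q = v"
    using st unfolding rho1_def rho2_def s_def[symmetric] t_def[symmetric]
    by (simp_all add: point_eq_iff field_simps)
  show "?q \<in> triangles"
  proof (rule ccontr)
    assume "?q \<notin> triangles"
    then have "rho1 ?q = 0 \<and> rho2 ?q = 0"
      by (auto simp: triangles_def rho1_def rho2_def point_eq_iff)
    with 1 2 assms show False by simp
  qed
qed

lemma shape_rel_if_rho:
  assumes "p \<in> triangles" "q \<in> triangles" "a\<^sup>2 + b\<^sup>2 \<noteq> 0"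
    and "rho1 q = similarity a b (rho1 p)" "rho2 q = similarity a b (rho2 p)"
  shows "(p, q) \<in> shape_rel"
proof -
  obtain p1 p2 p3 q1 q2 q3 where [simp]: "p = (p1, p2, p3)" "q = (q1, q2, q3)"
    by (cases p, cases q)
  have sc: "similarity a b (r *\<^sub>R x) = r *\<^sub>R similarity a b x" for r x
    by (simp add: point_eq_iff algebra_simps)
  have 1: "q3 - q2 = similarity a b (p3 - p2)"
    and 2: "q1 - (1/2) *\<^sub>R (q2 + q3) = similarity a b (p1 - (1/2) *\<^sub>R (p2 + p3))"
    using assms(4,5) by (simp_all add: rho1_def rho2_def sc)
  define t where "t = q2 - similarity a b p2"
  have "q2 = similarity a b p2 + t" by (simp add: t_def)
  moreover have "q3 = similarity a b p3 + t" "q1 = similarity a b p1 + t"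
    using 1 2 unfolding t_def point_eq_iff by (simp_all add: algebra_simps)
  ultimately show ?thesis using assms(1-3) by (auto simp: shape_rel_iff)
qed

lemma triangle_point_sphere:
  assumes "q \<in> triangles"
  shows "triangle_point q \<in> sphere 0 1"
proof -
  define u v where "u = rho1 q" and "v = rho2 q"
  define n where "n = u \<bullet> u + v \<bullet> v"
  have n: "n > 0" using rho_nonzero[OF assms] by (simp add: n_def u_def v_def)
  have "(2 * (u \<bullet> v))\<^sup>2 + (2 * cross2 u v)\<^sup>2 + (u \<bullet> u - v \<bullet> v)\<^sup>2 = n\<^sup>2"
    by (simp add: n_def inner_point cross2_def power2_eq_square algebra_simps)
  then have "(2 * (u \<bullet> v) / n)\<^sup>2 + (2 * cross2 u v / n)\<^sup>2 + ((u \<bullet> u - v \<bullet> v) / n)\<^sup>2 = 1"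
    using n by (simp add: power_divide flip: add_divide_distrib)
  then have "(triangle_point q $ 1)\<^sup>2 + (triangle_point q $ 2)\<^sup>2 + (triangle_point q $ 3)\<^sup>2 = 1"
    unfolding triangle_point_nth u_def[symmetric] v_def[symmetric] n_def[symmetric] .
  then have "triangle_point q \<bullet> triangle_point q = 1"
    unfolding inner_vec_def sum_3 by (simp add: power2_eq_square)
  then show ?thesis by (simp add: norm_eq_sqrt_inner)
qed

lemma triangle_point_inj:
  assumes p: "p \<in> triangles" and q: "q \<in> triangles" and eq: "triangle_point p = triangle_point q"
  shows "(p, q) \<in> shape_rel"
proof -
  define u v u' v' where "u = rho1 p" and "v = rho2 p" and "u' = rho1 q" and "v' = rho2 q"
  define n n' where "n = u \<bullet> u + v \<bullet> v" and "n' = u' \<bullet> u' + v' \<bullet> v'"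
  note defs = u_def v_def u'_def v'_def
  have n: "n > 0" "n' > 0"
    using rho_nonzero[OF p] rho_nonzero[OF q] by (simp_all add: n_def n'_def defs)
  define k where "k = n' / n"
  have k: "k > 0" using n by (simp add: k_def)
  have nk: "n' = k * n" using n by (simp add: k_def)
  have e: "2 * (u' \<bullet> v') / n' = 2 * (u \<bullet> v) / n" "2 * cross2 u' v' / n' = 2 * cross2 u v / n"
    "(u' \<bullet> u' - v' \<bullet> v') / n' = (u \<bullet> u - v \<bullet> v) / n"
    using arg_cong[OF eq, of "\<lambda>x. x$1"] arg_cong[OF eq, of "\<lambda>x. x$2"]
      arg_cong[OF eq, of "\<lambda>x. x$3"]
    by (simp_all add: triangle_point_nth n_def n'_def defs)
  have f: "x = k * y" if "2 * x / n' = 2 * y / n" for x y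
    using that n by (simp add: k_def field_simps)
  have i: "u' \<bullet> v' = k * (u \<bullet> v)" and c: "cross2 u' v' = k * cross2 u v"
    using e(1,2) by (simp_all only: f)
  have "u' \<bullet> u' - v' \<bullet> v' = k * (u \<bullet> u - v \<bullet> v)"
    using e(3) n by (simp add: k_def field_simps)
  moreover have "u' \<bullet> u' + v' \<bullet> v' = k * (u \<bullet> u + v \<bullet> v)"
    using nk by (simp add: n_def n'_def)
  ultimately have uu: "u' \<bullet> u' = k * (u \<bullet> u)" and vv: "v' \<bullet> v' = k * (v \<bullet> v)"
    by (simp_all add: algebra_simps)
  have step: "\<exists>a b. a\<^sup>2 + b\<^sup>2 \<noteq> 0 \<and> x' = similarity a b x \<and> y' = similarity a b y"
    if "x \<noteq> 0" "x' \<bullet> x' = k * (x \<bullet> x)" "x' \<bullet> y' = k * (x \<bullet> y)" "cross2 x' y' = k * cross2 x y"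
    for x y x' y'
  proof -
    define m where "m = x \<bullet> x"
    have m: "m > 0" using that(1) by (simp add: m_def)
    define m' where "m' = x' \<bullet> x'"
    have m': "m' = k * m" "m' > 0" using that m k by (simp_all add: m_def m'_def)
    have mm: "m = x$1 * x$1 + x$2 * x$2" "m' = x'$1 * x'$1 + x'$2 * x'$2"
      by (simp_all add: m_def m'_def inner_point)
    define a b where "a = (x \<bullet> x') / m" and "b = cross2 x x' / m"
    have ab: "m * a = x$1 * x'$1 + x$2 * x'$2" "m * b = x$1 * x'$2 - x$2 * x'$1"
      using m by (simp_all add: a_def b_def inner_point cross2_def)
    have "m\<^sup>2 * (a\<^sup>2 + b\<^sup>2) = (m * a)\<^sup>2 + (m * b)\<^sup>2"
      by (simp add: power_mult_distrib distrib_left)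
    also have "\<dots> = m * m'"
      unfolding ab unfolding mm by (simp add: power2_eq_square algebra_simps)
    finally have nz: "a\<^sup>2 + b\<^sup>2 \<noteq> 0" using m m'(2) by auto
    have s: "m *\<^sub>R similarity a b z = vector [(m * a) * z$1 - (m * b) * z$2, (m * b) * z$1 + (m * a) * z$2]" for z
      by (simp add: point_eq_iff algebra_simps)
    have x: "m *\<^sub>R similarity a b x = m *\<^sub>R x'"
      unfolding s ab by (simp add: point_eq_iff mm algebra_simps)
    have "m *\<^sub>R similarity a b y = m *\<^sub>R y'"
    proof -
      have "m *\<^sub>R similarity a b y =
          vector [x'$1 * (x \<bullet> y) - x'$2 * cross2 x y, x'$2 * (x \<bullet> y) + x'$1 * cross2 x y]"
        unfolding s ab by (simp add: point_eq_iff inner_point cross2_def algebra_simps)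
      then have "k *\<^sub>R m *\<^sub>R similarity a b y =
          vector [x'$1 * (x' \<bullet> y') - x'$2 * cross2 x' y', x'$2 * (x' \<bullet> y') + x'$1 * cross2 x' y']"
        unfolding that(3,4) by (simp only:) (simp add: point_eq_iff algebra_simps)
      also have "\<dots> = m' *\<^sub>R y'"
        unfolding point_eq_iff by (simp add: mm inner_point cross2_def algebra_simps)
      finally have "k *\<^sub>R m *\<^sub>R similarity a b y = k *\<^sub>R m *\<^sub>R y'"
        by (simp add: m'(1))
      then show ?thesis using k by simp
    qed
    with x nz m show ?thesis
      by (metis less_numeral_extra(3) scaleR_cancel_left)
  qed
  have "\<exists>a b. a\<^sup>2 + b\<^sup>2 \<noteq> 0 \<and> u' = similarity a b u \<and> v' = similarity a b v"
  proof (cases "u = 0")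
    case False
    then show ?thesis using step[OF _ uu i c] by blast
  next
    case True
    then have "v \<noteq> 0" using n by (auto simp: n_def)
    moreover have "v' \<bullet> u' = k * (v \<bullet> u)" using i by (simp add: inner_commute)
    moreover have "cross2 v' u' = k * cross2 v u"
    proof -
      have "cross2 w z = - cross2 z w" for w z by (simp add: cross2_def)
      then show ?thesis using c by (metis mult_minus_right)
    qed
    ultimately show ?thesis using step[of v v' u' u] vv by blast
  qed
  then show ?thesis
    using shape_rel_if_rho[OF p q] by (auto simp: defs)
qed

lemma triangle_point_surj:
  assumes "P \<in> sphere 0 1"
  shows "\<exists>q\<in>triangles. triangle_point q = P"
proof -
  have "P \<bullet> P = 1" using assms by (simp add: norm_eq_sqrt_inner)
  then have P: "P$1 * P$1 + P$2 * P$2 + P$3 * P$3 = 1"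
    by (simp add: inner_vec_def sum_3)
  show ?thesis
  proof (cases "P$3 = -1")
    case True
    then have "P$1 = 0" "P$2 = 0"
      using P sum_squares_eq_zero_iff[of "P$1" "P$2"] by auto
    obtain q where "q \<in> triangles" "rho1 q = 0" "rho2 q = vector [1, 0]"
      by (rule triangle_of_rho[of 0 "vector [1, 0]"]) (auto simp: point_eq_iff)
    with \<open>P$1 = 0\<close> \<open>P$2 = 0\<close> True have "triangle_point q = P"
      by (simp add: vec_eq_iff forall_3 triangle_point_nth inner_point cross2_def)
    with \<open>q \<in> triangles\<close> show ?thesis by blast
  next
    case False
    define z where "z = 1 + P$3"
    have z: "z \<noteq> 0" using False by (simp add: z_def)
    have xy: "P$1 * P$1 + P$2 * P$2 = 2 * z - z * z"
      using P by (simp add: z_def algebra_simps)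
    obtain q where q: "q \<in> triangles" "rho1 q = vector [z, 0]" "rho2 q = vector [P$1, P$2]"
      by (rule triangle_of_rho[of "vector [z, 0]" "vector [P$1, P$2]"])
        (use z in \<open>auto simp: point_eq_iff\<close>)
    have r: "rho1 q \<bullet> rho1 q = z * z" "rho2 q \<bullet> rho2 q = 2 * z - z * z"
      using q by (simp_all add: inner_point xy)
    have "triangle_point q $ 1 = P$1" "triangle_point q $ 2 = P$2"
      using q z unfolding triangle_point_nth r by (simp_all add: inner_point cross2_def)
    moreover have "triangle_point q $ 3 = z - 1"
      unfolding triangle_point_nth r using z by (simp add: field_simps)
    ultimately have "triangle_point q = P"
      by (simp add: vec_eq_iff forall_3 z_def)
    with q show ?thesis by blast
  qed
qed

theorem bij_betw_shape_point: "bij_betw shape_point shapes (sphere 0 1)"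
proof (rule bij_betw_imageI)
  show "inj_on shape_point shapes"
  proof (rule inj_onI)
    fix S T assume "S \<in> shapes" "T \<in> shapes" and e: "shape_point S = shape_point T"
    then obtain p q where pq: "p \<in> triangles" "q \<in> triangles"
      and ST: "S = shape_rel `` {p}" "T = shape_rel `` {q}"
      by (auto simp: shapes_def quotient_def)
    have "triangle_point p = triangle_point q"
      using e unfolding ST by (simp only: shape_point_class pq)
    then have "(p, q) \<in> shape_rel"
      by (rule triangle_point_inj[OF pq])
    then show "S = T"
      unfolding ST by (rule equiv_class_eq[OF equiv_shape_rel])
  qed
  have "shape_point ` shapes = triangle_point ` triangles"
    unfolding shapes_def quotient_def by (auto simp: shape_point_class image_iff)
  also have "\<dots> = sphere 0 1"
    using triangle_point_sphere triangle_point_surj by blast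
  finally show "shape_point ` shapes = sphere 0 1" .
qed

lemma area_element_spherical: "area_element spherical u v = \<bar>sin u\<bar>"
proof -
  have vd: "((\<lambda>s. vector [f s, g s, h s] :: real^3) has_vector_derivative vector [f', g', h']) (at x)"
    if "(f has_real_derivative f') (at x)" "(g has_real_derivative g') (at x)"
      "(h has_real_derivative h') (at x)" for f g h :: "real \<Rightarrow> real" and f' g' h' x
  proof -
    have r: "(vector [a, b, c] :: real^3) = a *\<^sub>R axis 1 1 + b *\<^sub>R axis 2 1 + c *\<^sub>R axis 3 1" for a b c
      by (simp add: vec_eq_iff forall_3 axis_def)
    show ?thesis
      unfolding r using that
      by (auto intro!: derivative_eq_intros simp: has_real_derivative_iff_has_vector_derivative)
  qed
  have "((\<lambda>s. spherical s v) has_vector_derivative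
      vector [cos u * sin v, - sin u, cos u * cos v]) (at u)"
    unfolding spherical_def by (rule vd) (auto intro!: derivative_eq_intros)
  moreover have "((\<lambda>t. spherical u t) has_vector_derivative
      vector [sin u * cos v, 0, - (sin u * sin v)]) (at v)"
    unfolding spherical_def by (rule vd) (auto intro!: derivative_eq_intros)
  ultimately have "area_element spherical u v = norm (cross3
      (vector [cos u * sin v, - sin u, cos u * cos v]) (vector [sin u * cos v, 0, - (sin u * sin v)]))"
    by (simp add: area_element_def vector_derivative_at)
  also have "\<dots> = sqrt ((sin u * sin u * sin v)\<^sup>2 + (sin u * cos u)\<^sup>2 + (sin u * sin u * cos v)\<^sup>2)"
  proof -
    have "sin u * cos v * (cos u * cos v) + cos u * sin v * (sin u * sin v) =
        sin u * cos u * ((sin v)\<^sup>2 + (cos v)\<^sup>2)"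
      by (simp only: power2_eq_square algebra_simps)
    then show ?thesis
      by (simp add: cross3_def norm_eq_sqrt_inner inner_vec_def sum_3 power2_eq_square algebra_simps)
  qed
  also have "(sin u * sin u * sin v)\<^sup>2 + (sin u * cos u)\<^sup>2 + (sin u * sin u * cos v)\<^sup>2 =
      (sin u)\<^sup>2 * ((sin u)\<^sup>2 * ((sin v)\<^sup>2 + (cos v)\<^sup>2) + (cos u)\<^sup>2)"
    by (simp only: power2_eq_square algebra_simps)
  finally show ?thesis by simp
qed

theorem sphere_area_total: "emeasure sphere_area (sphere 0 1) = ennreal (4 * pi)"
proof -
  let ?D = "{0..pi} \<times> {0..<2 * pi}"
  have n1: "norm (spherical u v) = 1" for u v
  proof -
    have "spherical u v \<bullet> spherical u v = (sin u)\<^sup>2 * ((sin v)\<^sup>2 + (cos v)\<^sup>2) + (cos u)\<^sup>2"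
      unfolding distrib_left
      by (simp add: spherical_def inner_vec_def sum_3 power2_eq_square del: sin_cos_squared_add3)
    then show ?thesis by (simp only: norm_eq_sqrt_inner sin_cos_squared_add mult_1_right real_sqrt_one)
  qed
  have "spherical u v = (sin u * sin v) *\<^sub>R axis 1 1 + cos u *\<^sub>R axis 2 1 + (sin u * cos v) *\<^sub>R axis 3 1" for u v
    by (simp add: spherical_def vec_eq_iff forall_3 axis_def)
  then have "continuous_on UNIV (\<lambda>(u, v). spherical u v)"
    by (auto simp: case_prod_beta intro!: continuous_intros)
  then have "(\<lambda>(u, v). spherical u v) \<in> borel_measurable borel"
    by (rule borel_measurable_continuous_onI)
  then have ms: "(\<lambda>(u, v). spherical u v) \<in> restrict_space lborel ?D \<rightarrow>\<^sub>M restrict_space borel (sphere 0 1)"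
    using n1 by (intro measurable_restrict_space2 measurable_restrict_space1) auto
  have mD: "?D \<in> sets borel"
    by (simp add: borel_prod[symmetric])
  have me: "(\<lambda>(u, v). ennreal \<bar>sin u\<bar>) \<in> borel_measurable (borel :: (real \<times> real) measure)"
    unfolding borel_prod[symmetric] by measurable
  have "emeasure sphere_area (sphere 0 1) =
      emeasure (density (restrict_space lborel ?D) (\<lambda>(u, v). ennreal \<bar>sin u\<bar>)) ?D"
    unfolding sphere_area_def surface_area_def area_element_spherical
    using n1 ms
    by (subst emeasure_distr)
      (auto simp: sets_restrict_space space_restrict_space intro!: arg_cong2[where f = emeasure])
  also have "\<dots> = (\<integral>\<^sup>+ x. (case x of (u, v) \<Rightarrow> ennreal \<bar>sin u\<bar>) * indicator ?D x \<partial>restrict_space lborel ?D)"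
    using me by (subst emeasure_density)
      (auto intro!: measurable_restrict_space1 simp: sets_restrict_space)
  also have "\<dots> = (\<integral>\<^sup>+ x. (case x of (u, v) \<Rightarrow> ennreal \<bar>sin u\<bar>) * indicator ?D x * indicator ?D x \<partial>lborel)"
    using mD by (subst nn_integral_restrict_space) auto
  also have "\<dots> = (\<integral>\<^sup>+ x. (case x of (u, v) \<Rightarrow> ennreal \<bar>sin u\<bar> * indicator {0..pi} u * indicator {0..<2 * pi} v)
      \<partial>(lborel \<Otimes>\<^sub>M lborel))"
    unfolding lborel_prod by (intro nn_integral_cong) (auto simp: indicator_def)
  also have "\<dots> = (\<integral>\<^sup>+ u. \<integral>\<^sup>+ v. ennreal \<bar>sin u\<bar> * indicator {0..pi} u * indicator {0..<2 * pi} v \<partial>lborel \<partial>lborel)"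
    by (subst lborel.nn_integral_fst[symmetric]) auto
  also have "\<dots> = (\<integral>\<^sup>+ u. ennreal \<bar>sin u\<bar> * indicator {0..pi} u \<partial>lborel) * ennreal (2 * pi)"
    by (simp add: nn_integral_cmult nn_integral_multc)
  also have "(\<integral>\<^sup>+ u. ennreal \<bar>sin u\<bar> * indicator {0..pi} u \<partial>lborel) =
      (\<integral>\<^sup>+ u. ennreal (sin u) * indicator {0..pi} u \<partial>lborel)"
    by (intro nn_integral_cong) (auto split: split_indicator simp: sin_ge_zero)
  also have "\<dots> = ennreal (- cos pi - - cos 0)"
    by (intro nn_integral_FTC_Icc) (auto intro!: derivative_eq_intros sin_ge_zero)
  also have "ennreal (- cos pi - - cos 0) * ennreal (2 * pi) = ennreal (4 * pi)"
    by (subst ennreal_mult[symmetric]) auto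
  finally show ?thesis .
qed

lemma prob_space_sphere_uniform: "prob_space sphere_uniform"
proof (rule prob_spaceI)
  have "space sphere_uniform = sphere 0 1"
    by (simp add: sphere_uniform_def sphere_area_def surface_area_def space_restrict_space
        space_scale_measure)
  then show "emeasure sphere_uniform (space sphere_uniform) = 1"
    by (simp add: sphere_uniform_def sphere_area_total flip: ennreal_mult)
qed

end

theory Submission
  imports Defs
begin

text \<open>A triangle is obtuse at a given vertex exactly if the sides leaving that vertex have a negative
  inner product. In the coordinates of the shape sphere this inner product, divided by
  \<open>\<rho>\<^sub>1\<^sup>2 + \<rho>\<^sub>2\<^sup>2\<close>, is \<open>1/2 - e \<bullet> P\<close>, where \<open>P\<close> is the shape and \<open>e\<close> is the collinear shape with that vertex
  at the midpoint of the other two (\<open>inner_at_vertex\<close>). Hence the shapes that are obtuse at this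
  vertex form, up to collinear ones, the open spherical cap \<open>e \<bullet> P > 1/2\<close> of angular radius \<open>\<pi>/3\<close>.

  By Archimedes, a cap \<open>e \<bullet> P > h\<close> has area \<open>2\<pi> (1 - h)\<close>, so each of the three caps has
  probability \<open>1/4\<close> (\<open>emeasure_cap\<close>, \<open>prob_cap\<close>). The three centres are equally spaced on the equator
  of collinear shapes, \<open>2\<pi>/3\<close> apart, which is twice the angular radius: the caps touch but do not
  overlap (\<open>midpoint_caps_disjoint\<close>). Their union has probability \<open>3/4\<close>. The acute shapes are the
  complement of this union, up to the three bounding circles of right-angled shapes
  (\<open>circle_null\<close>) and the equator (\<open>equator_null\<close>), which have area zero.\<close>

section \<open>Properties of shapes as subsets of the sphere\<close>

text \<open>This reduces the probability of a property of shapes to the measure of a set of unit vectors: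
  the property is tested on one representative, because the assumption makes it constant on shapes,
  and every unit vector is the point of some shape.\<close>
lemma shape_point_image:
  assumes "\<And>q. q \<in> triangles \<Longrightarrow> P q \<longleftrightarrow> Q (triangle_point q)"
  shows "shape_point ` {S \<in> shapes. \<forall>q\<in>S. P q} = {x \<in> sphere 0 1. Q x}"
proof -
  have rep: "shape_point (shape_rel `` {q}) = triangle_point q"
    "(\<forall>p\<in>shape_rel `` {q}. P p) \<longleftrightarrow> Q (triangle_point q)" if "q \<in> triangles" for q
  proof -
    show "shape_point (shape_rel `` {q}) = triangle_point q"
      by (rule shape_point_class[OF that])
    have "P p \<longleftrightarrow> Q (triangle_point q)" if "p \<in> shape_rel `` {q}" for p
    proof -
      from that have r: "(q, p) \<in> shape_rel" by simp
      then have "p \<in> triangles" by (auto simp: shape_rel_def)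
      then show ?thesis using assms triangle_point_invariant[OF r] by simp
    qed
    moreover have "q \<in> shape_rel `` {q}"
      by (rule equiv_class_self[OF equiv_shape_rel that])
    ultimately show "(\<forall>p\<in>shape_rel `` {q}. P p) \<longleftrightarrow> Q (triangle_point q)" by blast
  qed
  have "shape_point ` {S \<in> shapes. \<forall>q\<in>S. P q} = {x \<in> triangle_point ` triangles. Q x}"
  proof (intro equalityI subsetI)
    fix x assume "x \<in> shape_point ` {S \<in> shapes. \<forall>q\<in>S. P q}"
    then obtain S where S: "S \<in> shapes" "\<forall>q\<in>S. P q" "x = shape_point S" by blast
    then obtain q where q: "q \<in> triangles" "S = shape_rel `` {q}"
      unfolding shapes_def by (blast elim: quotientE)
    have "x = triangle_point q" "Q x"
      using S(2,3) rep[OF q(1)] unfolding q(2) by simp_all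
    with q(1) show "x \<in> {x \<in> triangle_point ` triangles. Q x}" by blast
  next
    fix x assume "x \<in> {x \<in> triangle_point ` triangles. Q x}"
    then obtain q where q: "q \<in> triangles" "x = triangle_point q" "Q x" by blast
    have "\<forall>p\<in>shape_rel `` {q}. P p" "x = shape_point (shape_rel `` {q})"
      using rep[OF q(1)] q(2,3) by simp_all
    moreover have "shape_rel `` {q} \<in> shapes"
      unfolding shapes_def by (rule quotientI) fact
    ultimately show "x \<in> shape_point ` {S \<in> shapes. \<forall>q\<in>S. P q}" by blast
  qed
  also have "triangle_point ` triangles = sphere 0 1"
    using triangle_point_sphere triangle_point_surj by blast
  finally show ?thesis by simp
qed

section \<open>Obtuse shapes as spherical caps\<close>

text \<open>On a unit vector this is the cosine of the angular distance to the point of azimuth \<open>\<phi>\<close>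
  on the equator of collinear shapes.\<close>
definition height :: "real \<Rightarrow> real^3 \<Rightarrow> real" where
  "height \<phi> P = P$1 * sin \<phi> + P$3 * cos \<phi>"

definition cap :: "real \<Rightarrow> real \<Rightarrow> (real^3) set" where
  "cap \<phi> h = {P \<in> sphere 0 1. h < height \<phi> P}"

text \<open>The three collinear shapes in which one vertex is the midpoint of the other two. With \<open>q1\<close> in
  the middle \<open>R\<^sub>2 = 0\<close>, so \<open>Z = 1\<close> and the azimuth is \<open>0\<close>; the azimuths \<open>4\<pi>/3\<close> and \<open>2\<pi>/3\<close> belong
  to \<open>q2\<close> and \<open>q3\<close>.\<close>
abbreviation midpoint_azimuths :: "real set" where
  "midpoint_azimuths \<equiv> {0, 2 * pi / 3, 4 * pi / 3}"

lemma trig_thirds: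
  "sin (2 * pi / 3) = sqrt 3 / 2" "cos (2 * pi / 3) = - 1 / 2"
  "sin (4 * pi / 3) = - sqrt 3 / 2" "cos (4 * pi / 3) = - 1 / 2"
proof -
  show "sin (2 * pi / 3) = sqrt 3 / 2" "cos (2 * pi / 3) = - 1 / 2"
    using sin_120 cos_120 by simp_all
  have "4 * pi / 3 = pi / 3 + pi" by simp
  then show "sin (4 * pi / 3) = - sqrt 3 / 2" "cos (4 * pi / 3) = - 1 / 2"
    by (simp_all only: sin_periodic_pi cos_periodic_pi sin_60 cos_60)
qed

text \<open>The reason why right-angled shapes form round circles. The sides at \<open>q1\<close> are
  \<open>- R\<^sub>2 \<plusminus> R\<^sub>1 / 2\<close>, so their inner product is \<open>\<bar>R\<^sub>2\<bar>\<^sup>2 - \<bar>R\<^sub>1\<bar>\<^sup>2 / 4 = (3 \<rho>\<^sub>2\<^sup>2 - \<rho>\<^sub>1\<^sup>2) / 2\<close>. Since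
  \<open>\<rho>\<^sub>1\<^sup>2 = n (1 + Z) / 2\<close> and \<open>\<rho>\<^sub>2\<^sup>2 = n (1 - Z) / 2\<close>, this is affine in the coordinates of the
  shape. At the other two vertices the mixed term \<open>R\<^sub>1 \<bullet> R\<^sub>2 = \<surd>3 \<rho>\<^sub>1 \<bullet> \<rho>\<^sub>2\<close> contributes the coordinate
  \<open>X\<close> as well, which turns the axis by a third of a full turn.\<close>
lemma inner_at_vertex:
  fixes q1 q2 q3 :: point
  defines "q \<equiv> (q1, q2, q3)"
  defines "n \<equiv> rho1 q \<bullet> rho1 q + rho2 q \<bullet> rho2 q"
  assumes "q \<in> triangles"
  shows "(q2 - q1) \<bullet> (q3 - q1) = n * (1 / 2 - height 0 (triangle_point q))"
    and "(q3 - q2) \<bullet> (q1 - q2) = n * (1 / 2 - height (4 * pi / 3) (triangle_point q))"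
    and "(q1 - q3) \<bullet> (q2 - q3) = n * (1 / 2 - height (2 * pi / 3) (triangle_point q))"
proof -
  have n: "n > 0" unfolding n_def by (rule rho_nonzero) fact
  define x y where "x = q3 - q2" and "y = q1 - (1/2) *\<^sub>R (q2 + q3)"
  have r: "rho1 q = sqrt (1/2) *\<^sub>R x" "rho2 q = sqrt (2/3) *\<^sub>R y"
    by (simp_all add: rho1_def rho2_def q_def x_def y_def)
  have sq: "sqrt (1/2) * sqrt (1/2) = 1/2" "sqrt (2/3) * sqrt (2/3) = 2/3"
    "sqrt (1/2) * sqrt (2/3) = 1 / sqrt 3"
    by (simp_all flip: real_sqrt_mult add: real_sqrt_divide)
  have ip: "rho1 q \<bullet> rho1 q = x \<bullet> x / 2" "rho2 q \<bullet> rho2 q = 2 * (y \<bullet> y) / 3"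
    "rho1 q \<bullet> rho2 q = (x \<bullet> y) / sqrt 3"
  proof -
    have c: "(c *\<^sub>R v) \<bullet> (d *\<^sub>R w) = (c * d) * (v \<bullet> w)" for c d and v w :: point by simp
    show "rho1 q \<bullet> rho1 q = x \<bullet> x / 2" "rho2 q \<bullet> rho2 q = 2 * (y \<bullet> y) / 3"
      "rho1 q \<bullet> rho2 q = (x \<bullet> y) / sqrt 3"
      by (simp_all only: r c sq mult_1_left times_divide_eq_left)
  qed
  have n_eq: "n = x \<bullet> x / 2 + 2 * (y \<bullet> y) / 3" by (simp add: n_def ip)
  have Z: "n * triangle_point q $ 3 = x \<bullet> x / 2 - 2 * (y \<bullet> y) / 3"
    and X: "n * triangle_point q $ 1 * sqrt 3 = 2 * (x \<bullet> y)"
    using n unfolding triangle_point_nth n_def[symmetric] by (simp_all add: ip)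
  have e: "q2 - q1 = - y - (1/2) *\<^sub>R x" "q3 - q1 = - y + (1/2) *\<^sub>R x" "q3 - q2 = x"
    "q1 - q2 = y + (1/2) *\<^sub>R x" "q1 - q3 = y - (1/2) *\<^sub>R x" "q2 - q3 = - x"
    by (simp_all add: x_def y_def point_eq_iff field_simps)
  show "(q2 - q1) \<bullet> (q3 - q1) = n * (1 / 2 - height 0 (triangle_point q))"
  proof -
    have eq: "n * (1 / 2 - height 0 (triangle_point q)) = n / 2 - n * triangle_point q $ 3"
      by (simp add: height_def right_diff_distrib)
    show ?thesis
      unfolding e eq Z unfolding n_eq
      by (simp add: inner_simps inner_commute add_divide_distrib diff_divide_distrib)
  qed
  show "(q3 - q2) \<bullet> (q1 - q2) = n * (1 / 2 - height (4 * pi / 3) (triangle_point q))"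
  proof -
    have eq: "n * (1 / 2 - height (4 * pi / 3) (triangle_point q)) =
        n / 2 + (n * triangle_point q $ 1 * sqrt 3) / 2 + n * triangle_point q $ 3 / 2"
      unfolding height_def trig_thirds by (simp add: algebra_simps)
    show ?thesis
      unfolding e eq X Z unfolding n_eq
      by (simp add: inner_simps inner_commute add_divide_distrib diff_divide_distrib)
  qed
  show "(q1 - q3) \<bullet> (q2 - q3) = n * (1 / 2 - height (2 * pi / 3) (triangle_point q))"
  proof -
    have eq: "n * (1 / 2 - height (2 * pi / 3) (triangle_point q)) =
        n / 2 - (n * triangle_point q $ 1 * sqrt 3) / 2 + n * triangle_point q $ 3 / 2"
      unfolding height_def trig_thirds by (simp add: algebra_simps)
    show ?thesis
      unfolding e eq X Z unfolding n_eq
      by (simp add: inner_simps inner_commute add_divide_distrib diff_divide_distrib)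
  qed
qed

text \<open>\<open>Y\<close> is a positive multiple of the signed area of the triangle.\<close>
lemma collinear_iff_equator:
  assumes "q \<in> triangles"
  shows "collinear_triangle q \<longleftrightarrow> triangle_point q $ 2 = 0"
proof -
  obtain q1 q2 q3 where [simp]: "q = (q1, q2, q3)" by (cases q)
  have "cross2 (s *\<^sub>R v) (t *\<^sub>R w) = s * t * cross2 v w" for s t v w
    by (simp add: cross2_def algebra_simps)
  then have "cross2 (rho1 q) (rho2 q) =
      sqrt (1/2) * sqrt (2/3) * cross2 (q3 - q2) (q1 - (1/2) *\<^sub>R (q2 + q3))"
    by (simp add: rho1_def rho2_def)
  also have "cross2 (q3 - q2) (q1 - (1/2) *\<^sub>R (q2 + q3)) = - cross2 (q1 - q2) (q3 - q2)"
    by (simp add: cross2_def field_simps)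
  finally show ?thesis
    using rho_nonzero[OF assms] by (simp add: triangle_point_nth collinear_iff_cross2)
qed

lemma angle_at_pi_half_iff:
  assumes "a \<noteq> b" "a \<noteq> c"
  shows "angle_at a b c > pi / 2 \<longleftrightarrow> (b - a) \<bullet> (c - a) < 0"
    and "angle_at a b c < pi / 2 \<longleftrightarrow> (b - a) \<bullet> (c - a) > 0"
proof -
  define d where "d = norm (b - a) * norm (c - a)"
  have d: "d > 0" using assms by (simp add: d_def)
  define t where "t = (b - a) \<bullet> (c - a) / d"
  have "\<bar>t\<bar> \<le> 1"
    using d Cauchy_Schwarz_ineq2[of "b - a" "c - a"] by (simp add: t_def d_def[symmetric])
  then have "arccos 0 < arccos t \<longleftrightarrow> t < 0" "arccos t < arccos 0 \<longleftrightarrow> 0 < t"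
    by (simp_all only: arccos_less_mono abs_zero zero_le_one)
  moreover have "t < 0 \<longleftrightarrow> (b - a) \<bullet> (c - a) < 0" "t > 0 \<longleftrightarrow> (b - a) \<bullet> (c - a) > 0"
    using d by (simp_all add: t_def divide_less_0_iff zero_less_divide_iff)
  ultimately show "angle_at a b c > pi / 2 \<longleftrightarrow> (b - a) \<bullet> (c - a) < 0"
    and "angle_at a b c < pi / 2 \<longleftrightarrow> (b - a) \<bullet> (c - a) > 0"
    by (simp_all add: angle_at_def t_def d_def)
qed

text \<open>The factor \<open>\<rho>\<^sub>1\<^sup>2 + \<rho>\<^sub>2\<^sup>2\<close> in the inner products is positive, so the angle at a vertex is
  decided by comparing the height over the corresponding midpoint configuration with \<open>1/2\<close>.\<close>
lemma
  assumes "q \<in> triangles"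
  shows obtuse_iff_height: "obtuse q \<longleftrightarrow> triangle_point q $ 2 \<noteq> 0 \<and>
      (\<exists>\<phi>\<in>midpoint_azimuths. height \<phi> (triangle_point q) > 1 / 2)" (is ?obtuse)
    and acute_iff_height: "acute q \<longleftrightarrow> triangle_point q $ 2 \<noteq> 0 \<and>
      (\<forall>\<phi>\<in>midpoint_azimuths. height \<phi> (triangle_point q) < 1 / 2)" (is ?acute)
proof -
  obtain q1 q2 q3 where q [simp]: "q = (q1, q2, q3)" by (cases q)
  have sgn: "n * (1 / 2 - t) < 0 \<longleftrightarrow> t > 1 / 2" "n * (1 / 2 - t) > 0 \<longleftrightarrow> t < 1 / 2"
    if "n > 0" for n t :: real
    using that by (simp_all add: mult_less_0_iff zero_less_mult_iff)
  have angles: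
    "angle_at q1 q2 q3 > pi / 2 \<longleftrightarrow> height 0 (triangle_point q) > 1 / 2"
    "angle_at q2 q3 q1 > pi / 2 \<longleftrightarrow> height (4 * pi / 3) (triangle_point q) > 1 / 2"
    "angle_at q3 q1 q2 > pi / 2 \<longleftrightarrow> height (2 * pi / 3) (triangle_point q) > 1 / 2"
    "angle_at q1 q2 q3 < pi / 2 \<longleftrightarrow> height 0 (triangle_point q) < 1 / 2"
    "angle_at q2 q3 q1 < pi / 2 \<longleftrightarrow> height (4 * pi / 3) (triangle_point q) < 1 / 2"
    "angle_at q3 q1 q2 < pi / 2 \<longleftrightarrow> height (2 * pi / 3) (triangle_point q) < 1 / 2"
    if "\<not> collinear_triangle q"
  proof -
    have "q1 \<noteq> q2" "q2 \<noteq> q3" "q3 \<noteq> q1"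
      using that by (auto simp: insert_commute)
    note ne = this this[symmetric]
    note iv = inner_at_vertex[OF assms[unfolded q]] sgn[OF rho_nonzero[OF assms[unfolded q]]]
    show "angle_at q1 q2 q3 > pi / 2 \<longleftrightarrow> height 0 (triangle_point q) > 1 / 2"
      "angle_at q2 q3 q1 > pi / 2 \<longleftrightarrow> height (4 * pi / 3) (triangle_point q) > 1 / 2"
      "angle_at q3 q1 q2 > pi / 2 \<longleftrightarrow> height (2 * pi / 3) (triangle_point q) > 1 / 2"
      "angle_at q1 q2 q3 < pi / 2 \<longleftrightarrow> height 0 (triangle_point q) < 1 / 2"
      "angle_at q2 q3 q1 < pi / 2 \<longleftrightarrow> height (4 * pi / 3) (triangle_point q) < 1 / 2"
      "angle_at q3 q1 q2 < pi / 2 \<longleftrightarrow> height (2 * pi / 3) (triangle_point q) < 1 / 2"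
      unfolding angle_at_pi_half_iff[OF ne(1) ne(6)] angle_at_pi_half_iff[OF ne(2) ne(4)]
        angle_at_pi_half_iff[OF ne(3) ne(5)] q iv
      by (rule refl)+
  qed
  have collinear: "collinear_triangle q \<longleftrightarrow> triangle_point q $ 2 = 0"
    by (rule collinear_iff_equator[OF assms])
  have ia: "interior_angles q = {angle_at q1 q2 q3, angle_at q2 q3 q1, angle_at q3 q1 q2}"
    by simp
  have three: "(\<exists>x\<in>{a, b, c}. Q x) \<longleftrightarrow> Q a \<or> Q b \<or> Q c" "(\<forall>x\<in>{a, b, c}. Q x) \<longleftrightarrow> Q a \<and> Q b \<and> Q c"
    for a b c :: real and Q by simp_all
  show ?obtuse
    unfolding obtuse_def ia three collinear[symmetric] using angles(1-3) by argo
  show ?acute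
    unfolding acute_def ia three collinear[symmetric] using angles(4-6) by argo
qed

section \<open>Integration over a period\<close>

text \<open>The part \<open>[a, b)\<close> that the second period misses is translated by \<open>p\<close> onto \<open>[a + p, b + p)\<close>.\<close>
lemma nn_integral_periodic:
  fixes g :: "real \<Rightarrow> ennreal"
  assumes [measurable]: "g \<in> borel_measurable borel"
    and periodic: "\<And>x. g (x + p) = g x" and "a \<le> b" "b \<le> a + p"
  shows "(\<integral>\<^sup>+x. g x * indicator {b..<b + p} x \<partial>lborel) = (\<integral>\<^sup>+x. g x * indicator {a..<a + p} x \<partial>lborel)"
proof -
  have "(\<integral>\<^sup>+x. g x * indicator {b..<b + p} x \<partial>lborel) =
      (\<integral>\<^sup>+x. g x * indicator {b..<a + p} x + g x * indicator {a + p..<b + p} x \<partial>lborel)"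
    using assms(3,4) by (intro nn_integral_cong) (auto split: split_indicator)
  also have "\<dots> = (\<integral>\<^sup>+x. g x * indicator {b..<a + p} x \<partial>lborel) +
      (\<integral>\<^sup>+x. g x * indicator {a + p..<b + p} x \<partial>lborel)"
    by (rule nn_integral_add) auto
  also have "(\<integral>\<^sup>+x. g x * indicator {a + p..<b + p} x \<partial>lborel) =
      (\<integral>\<^sup>+x. g (p + x) * indicator {a + p..<b + p} (p + x) \<partial>lborel)"
    by (subst nn_integral_real_affine[where c = 1 and t = p]) auto
  also have "\<dots> = (\<integral>\<^sup>+x. g x * indicator {a..<b} x \<partial>lborel)"
    by (intro nn_integral_cong) (auto split: split_indicator simp: periodic add.commute[of p])
  also have "(\<integral>\<^sup>+x. g x * indicator {b..<a + p} x \<partial>lborel) + \<dots> =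
      (\<integral>\<^sup>+x. g x * indicator {b..<a + p} x + g x * indicator {a..<b} x \<partial>lborel)"
    by (rule nn_integral_add[symmetric]) auto
  also have "\<dots> = (\<integral>\<^sup>+x. g x * indicator {a..<a + p} x \<partial>lborel)"
    using assms(3,4) by (intro nn_integral_cong) (auto split: split_indicator)
  finally show ?thesis .
qed

section \<open>The area measure in spherical coordinates\<close>

lemma borel_measurable_spherical [measurable]:
  "(\<lambda>(u, v). spherical u v) \<in> borel_measurable (borel \<Otimes>\<^sub>M borel)"
proof -
  have "spherical u v = (sin u * sin v) *\<^sub>R axis 1 1 + cos u *\<^sub>R axis 2 1 + (sin u * cos v) *\<^sub>R axis 3 1" for u v
    by (simp add: spherical_def vec_eq_iff forall_3 axis_def)
  then show ?thesis by (simp add: case_prod_beta)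
qed

lemma spherical_in_sphere: "spherical u v \<in> sphere 0 1"
proof -
  have "spherical u v \<bullet> spherical u v = (sin u)\<^sup>2 * ((sin v)\<^sup>2 + (cos v)\<^sup>2) + (cos u)\<^sup>2"
    unfolding distrib_left
    by (simp add: spherical_def inner_vec_def sum_3 power2_eq_square del: sin_cos_squared_add3)
  then show ?thesis by (simp add: norm_eq_sqrt_inner)
qed

text \<open>The polar angle \<open>u\<close> is integrated first because along a meridian the density \<open>sin u\<close> has an
  elementary primitive; integrating over the azimuth first would leave an integral involving
  \<open>arccos (h / sin u)\<close>.\<close>
lemma emeasure_sphere_area:
  assumes A: "A \<in> sets (restrict_space borel (sphere 0 1))"
  shows "emeasure sphere_area A =
    (\<integral>\<^sup>+v. (\<integral>\<^sup>+u. ennreal (sin u) * indicator {0..pi} u * indicator A (spherical u v) \<partial>lborel)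
      * indicator {0..<2 * pi} v \<partial>lborel)"
proof -
  let ?D = "{0..pi} \<times> {0..<2 * pi}"
  let ?S = "\<lambda>(u, v). spherical u v"
  have A' [measurable]: "A \<in> sets borel"
    using A by (subst (asm) sets_restrict_space_iff) auto
  have mS: "?S \<in> borel_measurable borel"
    using borel_measurable_spherical by (simp only: borel_prod)
  have ms: "?S \<in> restrict_space lborel ?D \<rightarrow>\<^sub>M restrict_space borel (sphere 0 1)"
    using spherical_in_sphere mS by (intro measurable_restrict_space2 measurable_restrict_space1) auto
  have mD: "?D \<in> sets borel"
    by (simp add: borel_prod[symmetric])
  have me: "(\<lambda>(u, v). ennreal \<bar>sin u\<bar>) \<in> borel_measurable (borel :: (real \<times> real) measure)"
    unfolding borel_prod[symmetric] by measurable
  have pre: "?S -` A \<inter> ?D \<in> sets (restrict_space lborel ?D)"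
    using measurable_sets[OF ms A] by (simp add: space_restrict_space)
  have "emeasure sphere_area A =
      emeasure (density (restrict_space lborel ?D) (\<lambda>(u, v). ennreal \<bar>sin u\<bar>)) (?S -` A \<inter> ?D)"
    unfolding sphere_area_def surface_area_def area_element_spherical
    using ms A by (subst emeasure_distr) (auto simp: space_restrict_space)
  also have "\<dots> = (\<integral>\<^sup>+ x. (case x of (u, v) \<Rightarrow> ennreal \<bar>sin u\<bar>) * indicator (?S -` A \<inter> ?D) x \<partial>restrict_space lborel ?D)"
    using me pre by (subst emeasure_density) (auto intro!: measurable_restrict_space1)
  also have "\<dots> = (\<integral>\<^sup>+ x. (case x of (u, v) \<Rightarrow> ennreal \<bar>sin u\<bar>) * indicator (?S -` A \<inter> ?D) x * indicator ?D x \<partial>lborel)"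
    using mD by (subst nn_integral_restrict_space) auto
  also have "\<dots> = (\<integral>\<^sup>+ x. (case x of (u, v) \<Rightarrow> ennreal (sin u) * indicator {0..pi} u * indicator A (spherical u v)
      * indicator {0..<2 * pi} v) \<partial>(lborel \<Otimes>\<^sub>M lborel))"
    unfolding lborel_prod by (intro nn_integral_cong) (auto simp: indicator_def sin_ge_zero)
  also have "\<dots> = (\<integral>\<^sup>+v. (\<integral>\<^sup>+u. ennreal (sin u) * indicator {0..pi} u * indicator A (spherical u v)
      * indicator {0..<2 * pi} v \<partial>lborel) \<partial>lborel)"
    by (subst lborel_pair.nn_integral_snd[symmetric]) auto
  also have "\<dots> = (\<integral>\<^sup>+v. (\<integral>\<^sup>+u. ennreal (sin u) * indicator {0..pi} u * indicator A (spherical u v) \<partial>lborel)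
      * indicator {0..<2 * pi} v \<partial>lborel)"
    by (intro nn_integral_cong nn_integral_multc) auto
  finally show ?thesis .
qed

section \<open>The area of a spherical cap\<close>

text \<open>The part of a meridian inside a cap of height \<open>h\<close> whose centre has azimuth at distance \<open>w\<close>,
  measured with density \<open>sin u\<close>. The condition \<open>h < sin u * cos w\<close> says
  \<open>\<bar>cos u\<bar> < sqrt (1 - (h / cos w)\<^sup>2)\<close>, and \<open>sin u du = - d(cos u)\<close> turns the measure into the length
  of that interval for \<open>cos u\<close>. For \<open>cos w \<le> h\<close> the meridian misses the cap.\<close>
definition cap_slice :: "real \<Rightarrow> real \<Rightarrow> real" where
  "cap_slice h w = (if h < cos w then 2 * sqrt (1 - (h / cos w)\<^sup>2) else 0)"

lemma nn_integral_cap_slice: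
  assumes "0 < h"
  shows "(\<integral>\<^sup>+u. ennreal (sin u) * indicator {0..pi} u * indicator {u. h < sin u * cos w} u \<partial>lborel) =
    ennreal (cap_slice h w)"
proof (cases "h < cos w")
  case False
  have "\<not> h < sin u * cos w" if "u \<in> {0..pi}" for u
  proof -
    have "0 \<le> sin u" "sin u \<le> 1" using that by (auto intro: sin_ge_zero)
    then have "sin u * cos w \<le> sin u * h" "sin u * h \<le> 1 * h"
      using False assms by (intro mult_left_mono mult_right_mono; simp)+
    then show ?thesis by simp
  qed
  then have "(\<integral>\<^sup>+u. ennreal (sin u) * indicator {0..pi} u * indicator {u. h < sin u * cos w} u \<partial>lborel)
      = (\<integral>\<^sup>+u. 0 \<partial>(lborel :: real measure))"
    by (intro nn_integral_cong) (auto split: split_indicator)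
  then show ?thesis using False by (simp add: cap_slice_def)
next
  case True
  define t where "t = h / cos w"
  define s where "s = sqrt (1 - t\<^sup>2)"
  have t: "0 < t" "t < 1" using True assms by (simp_all add: t_def)
  then have t2: "t\<^sup>2 < 1" by (simp add: power_less_one_iff)
  have s: "0 < s" "s \<le> 1" "s\<^sup>2 = 1 - t\<^sup>2" using t2 by (simp_all add: s_def)
  let ?a = "arccos s" and ?b = "arccos (- s)"
  have ab: "0 \<le> ?a" "?a \<le> ?b" "?b \<le> pi"
    using s by (auto intro: arccos_lbound arccos_ubound arccos_le_arccos)
  have "h < sin u * cos w \<longleftrightarrow> ?a < u \<and> u < ?b" if u: "u \<in> {0..pi}" for u
  proof -
    have "h < sin u * cos w \<longleftrightarrow> t < sin u"
      using True assms by (simp add: t_def divide_less_eq)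
    also have "\<dots> \<longleftrightarrow> t\<^sup>2 < (sin u)\<^sup>2"
      using t(1) u sin_ge_zero[of u] by (auto intro: power_strict_mono power2_less_imp_less)
    also have "\<dots> \<longleftrightarrow> (cos u)\<^sup>2 < s\<^sup>2"
      by (auto simp: s(3) sin_squared_eq)
    also have "\<dots> \<longleftrightarrow> \<bar>cos u\<bar> < s"
      using s(1) abs_le_square_iff[of s "cos u"] by auto
    also have "\<dots> \<longleftrightarrow> cos u < cos ?a \<and> cos ?b < cos u"
      using s by (auto simp: cos_arccos)
    also have "\<dots> \<longleftrightarrow> ?a < u \<and> u < ?b"
      using u ab by (subst (1 2) cos_mono_less_eq) auto
    finally show ?thesis .
  qed
  then have "(\<integral>\<^sup>+u. ennreal (sin u) * indicator {0..pi} u * indicator {u. h < sin u * cos w} u \<partial>lborel) =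
      (\<integral>\<^sup>+u. ennreal (sin u) * indicator {?a..?b} u \<partial>lborel)"
    using ab AE_lborel_singleton[of ?a] AE_lborel_singleton[of ?b]
    by (intro nn_integral_cong_AE) (auto split: split_indicator)
  also have "\<dots> = ennreal (- cos ?b - - cos ?a)"
    using ab by (intro nn_integral_FTC_Icc) (auto intro!: derivative_eq_intros sin_ge_zero)
  also have "- cos ?b - - cos ?a = cap_slice h w"
    using s True by (simp add: cos_arccos cap_slice_def) (simp add: s_def t_def)
  finally show ?thesis .
qed

text \<open>With \<open>k = sqrt (1 - h\<^sup>2)\<close> a primitive is
  \<open>2 arcsin (sin w / k) - 2 h arcsin (h tan w / k)\<close>. It is found by substituting \<open>s = sin w\<close>, which
  turns the integrand into \<open>2 sqrt (k\<^sup>2 - s\<^sup>2) / (1 - s\<^sup>2)\<close>, and writing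
  \<open>k\<^sup>2 - s\<^sup>2 = (1 - s\<^sup>2) - h\<^sup>2\<close>. At \<open>w = \<plusminus> arccos h\<close> both arguments reach \<open>\<plusminus> 1\<close>, where
  \<open>arcsin\<close> is continuous but not differentiable, so the fundamental theorem is needed in the form that
  asks for a derivative only in the interior.\<close>
lemma has_integral_cap_slice:
  assumes h: "0 < h" "h < 1"
  shows "((\<lambda>w. 2 * sqrt (1 - (h / cos w)\<^sup>2)) has_integral 2 * pi * (1 - h)) {- arccos h..arccos h}"
proof -
  define a where "a = arccos h"
  define k where "k = sqrt (1 - h\<^sup>2)"
  have h2: "h\<^sup>2 < 1" using h by (simp add: power_less_one_iff)
  have k: "0 < k" "k\<^sup>2 = 1 - h\<^sup>2" using h2 by (simp_all add: k_def)
  have cos_a: "cos a = h" using h by (simp add: a_def cos_arccos)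
  have a: "0 < a" "a < pi / 2"
    using h arccos_less_arccos[of h 1] arccos_less_arccos[of 0 h] by (auto simp: a_def)
  have sin_a: "sin a = k"
    using h by (simp add: a_def k_def sin_arccos)
  have cos_ge: "h \<le> cos w" if "w \<in> {-a..a}" for w
  proof -
    have "cos a \<le> cos \<bar>w\<bar>" using that a by (subst cos_mono_le_eq) auto
    then show ?thesis by (simp add: cos_a)
  qed
  have cos_gt: "h < cos w" if "w \<in> {-a<..<a}" for w
  proof -
    have "cos a < cos \<bar>w\<bar>" using that a by (subst cos_mono_less_eq) auto
    then show ?thesis by (simp add: cos_a)
  qed
  define F where "F = (\<lambda>w. 2 * arcsin (sin w / k) - 2 * h * arcsin (h * tan w / k))"
  have sin_le: "(sin w / k)\<^sup>2 \<le> 1" "(h * tan w / k)\<^sup>2 \<le> 1" if "h \<le> cos w" for w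
  proof -
    have "h\<^sup>2 \<le> (cos w)\<^sup>2" using that h by (intro power_mono) auto
    then show "(sin w / k)\<^sup>2 \<le> 1"
      using h2 by (simp add: power_divide k(2) sin_squared_eq)
    have "h\<^sup>2 * (1 - (cos w)\<^sup>2) \<le> (1 - h\<^sup>2) * (cos w)\<^sup>2"
      using \<open>h\<^sup>2 \<le> (cos w)\<^sup>2\<close> by (simp add: algebra_simps)
    moreover have "0 < (cos w)\<^sup>2" using that h by simp
    ultimately show "(h * tan w / k)\<^sup>2 \<le> 1"
      using h2 by (simp add: power_divide power_mult_distrib k(2) tan_def sin_squared_eq divide_le_eq mult.commute)
  qed
  have sin_less: "(sin w / k)\<^sup>2 < 1" "(h * tan w / k)\<^sup>2 < 1" if "h < cos w" for w
  proof -
    have "h\<^sup>2 < (cos w)\<^sup>2" using that h by (intro power_strict_mono) auto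
    then show "(sin w / k)\<^sup>2 < 1"
      using h2 by (simp add: power_divide k(2) sin_squared_eq)
    have "h\<^sup>2 * (1 - (cos w)\<^sup>2) < (1 - h\<^sup>2) * (cos w)\<^sup>2"
      using \<open>h\<^sup>2 < (cos w)\<^sup>2\<close> by (simp add: algebra_simps)
    moreover have "0 < (cos w)\<^sup>2" using that h by simp
    ultimately show "(h * tan w / k)\<^sup>2 < 1"
      using h2 by (simp add: power_divide power_mult_distrib k(2) tan_def sin_squared_eq divide_less_eq mult.commute)
  qed
  have "continuous_on {-a..a} F"
    unfolding F_def
  proof (intro continuous_intros ballI)
    fix w assume "w \<in> {-a..a}"
    note c = cos_ge[OF this]
    show "cos w \<noteq> 0" using c h by simp
    show "-1 \<le> sin w / k \<and> sin w / k \<le> 1" "-1 \<le> h * tan w / k \<and> h * tan w / k \<le> 1"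
      using sin_le[OF c] by (simp_all add: abs_square_le_1 abs_le_iff minus_le_iff del: abs_divide)
  qed (use k in auto)
  moreover have "(F has_vector_derivative 2 * sqrt (1 - (h / cos w)\<^sup>2)) (at w)" if "w \<in> {-a<..<a}" for w
  proof -
    note c = cos_gt[OF that]
    define r where "r = sqrt ((cos w)\<^sup>2 - h\<^sup>2)"
    have "h\<^sup>2 < (cos w)\<^sup>2" using c h by (intro power_strict_mono) auto
    then have r: "0 < r" "r\<^sup>2 = (cos w)\<^sup>2 - h\<^sup>2" by (simp_all add: r_def)
    have c0: "0 < cos w" using c h by simp
    have b: "-1 < sin w / k" "sin w / k < 1" "-1 < h * tan w / k" "h * tan w / k < 1"
      using sin_less[OF c] by (simp_all add: abs_square_less_1 abs_less_iff minus_less_iff del: abs_divide)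
    have s1: "sqrt (1 - (sin w / k)\<^sup>2) = r / k"
    proof (rule real_sqrt_unique)
      show "(r / k)\<^sup>2 = 1 - (sin w / k)\<^sup>2"
        using k h2 by (simp add: power_divide r(2) sin_squared_eq field_simps)
    qed (use r k in simp)
    have s2: "sqrt (1 - (h * tan w / k)\<^sup>2) = r / (k * cos w)"
    proof (rule real_sqrt_unique)
      have "(k * cos w)\<^sup>2 - (h * sin w)\<^sup>2 = r\<^sup>2"
        by (simp add: power_mult_distrib k(2) r(2) sin_squared_eq algebra_simps)
      then have "(r / (k * cos w))\<^sup>2 = 1 - (h * sin w / (k * cos w))\<^sup>2"
        using k(1) c0 by (simp add: power_divide diff_divide_distrib flip: \<open>_ = r\<^sup>2\<close>)
      then show "(r / (k * cos w))\<^sup>2 = 1 - (h * tan w / k)\<^sup>2"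
        by (simp add: tan_def mult.commute)
    qed (use r k c0 in simp)
    have s3: "sqrt (1 - (h / cos w)\<^sup>2) = r / cos w"
    proof (rule real_sqrt_unique)
      show "(r / cos w)\<^sup>2 = 1 - (h / cos w)\<^sup>2"
        using c0 by (simp add: power_divide r(2) field_simps)
    qed (use r c0 in simp)
    have "((\<lambda>w. sin w / k) has_real_derivative cos w / k) (at w)"
      using k(1) by (auto intro!: derivative_eq_intros)
    note d1 = DERIV_chain2[OF DERIV_arcsin[OF b(1,2), unfolded s1] this]
    have "((\<lambda>w. h * tan w / k) has_real_derivative h * inverse ((cos w)\<^sup>2) / k) (at w)"
      using k(1) c0 by (auto intro!: derivative_eq_intros)
    note d2 = DERIV_chain2[OF DERIV_arcsin[OF b(3,4), unfolded s2] this]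
    have "(F has_real_derivative 2 * (inverse (r / k) * (cos w / k)) -
        2 * h * (inverse (r / (k * cos w)) * (h * inverse ((cos w)\<^sup>2) / k))) (at w)"
      unfolding F_def by (rule DERIV_diff[OF DERIV_cmult[OF d1] DERIV_cmult[OF d2]])
    also have "2 * (inverse (r / k) * (cos w / k)) -
        2 * h * (inverse (r / (k * cos w)) * (h * inverse ((cos w)\<^sup>2) / k)) =
        2 * ((cos w)\<^sup>2 - h\<^sup>2) / (r * cos w)"
      using k c0 r(1) by (simp add: field_simps power2_eq_square)
    also have "\<dots> = 2 * sqrt (1 - (h / cos w)\<^sup>2)"
      unfolding s3 r(2)[symmetric] using r(1) by (simp add: power2_eq_square)
    finally show ?thesis by (simp add: has_real_derivative_iff_has_vector_derivative)
  qed
  ultimately have "((\<lambda>w. 2 * sqrt (1 - (h / cos w)\<^sup>2)) has_integral (F a - F (- a))) {-a..a}"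
    using a by (intro fundamental_theorem_of_calculus_interior) auto
  also have "F a - F (- a) = 2 * pi * (1 - h)"
    using h k(1) by (simp add: F_def sin_a cos_a tan_def algebra_simps)
  finally show ?thesis by (simp add: a_def)
qed

lemma nn_integral_cap_slice_period:
  assumes h: "0 < h" "h < 1"
  shows "(\<integral>\<^sup>+w. ennreal (cap_slice h w) * indicator {- pi..<- pi + 2 * pi} w \<partial>lborel) = ennreal (2 * pi * (1 - h))"
proof -
  let ?a = "arccos h"
  have a: "0 \<le> ?a" "?a < pi"
    using h arccos_less_arccos[of "-1" h] by (auto intro: arccos_lbound)
  have cos_iff: "h < cos w \<longleftrightarrow> \<bar>w\<bar> < ?a" if "\<bar>w\<bar> \<le> pi" for w
  proof -
    have "cos ?a < cos \<bar>w\<bar> \<longleftrightarrow> \<bar>w\<bar> < ?a" using that a by (subst cos_mono_less_eq) auto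
    then show ?thesis using h by (simp add: cos_arccos)
  qed
  have "ennreal (cap_slice h w) * indicator {- pi..<- pi + 2 * pi} w =
      ennreal (2 * sqrt (1 - (h / cos w)\<^sup>2)) * indicator {-?a..?a} w"
    if "w \<noteq> ?a" "w \<noteq> - ?a" for w
  proof (cases "w \<in> {- pi..<- pi + 2 * pi}")
    case True
    then have "\<bar>w\<bar> \<le> pi" by auto
    from cos_iff[OF this] have "h < cos w \<longleftrightarrow> w \<in> {-?a..?a}" using that by (auto simp: abs_less_iff)
    with True show ?thesis by (auto simp: cap_slice_def split: split_indicator)
  next
    case False
    with a show ?thesis by (auto split: split_indicator)
  qed
  then have "(\<integral>\<^sup>+w. ennreal (cap_slice h w) * indicator {- pi..<- pi + 2 * pi} w \<partial>lborel) =
      (\<integral>\<^sup>+w. ennreal (2 * sqrt (1 - (h / cos w)\<^sup>2)) * indicator {-?a..?a} w \<partial>lborel)"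
    using AE_lborel_singleton[of ?a] AE_lborel_singleton[of "- ?a"] by (intro nn_integral_cong_AE) auto
  also have "\<dots> = ennreal (2 * pi * (1 - h))"
  proof (rule nn_integral_has_integral_lebesgue'[OF _ has_integral_cap_slice[OF h]])
    fix w assume w: "w \<in> {- ?a..?a}"
    have "cos ?a \<le> cos \<bar>w\<bar>" using w a by (subst cos_mono_le_eq) auto
    then have "h \<le> cos w" using h by (simp add: cos_arccos)
    then have "(h / cos w)\<^sup>2 \<le> 1" using h by (intro power_le_one) auto
    then show "0 \<le> 2 * sqrt (1 - (h / cos w)\<^sup>2)" by simp
  qed
  finally show ?thesis .
qed

lemma borel_measurable_height [measurable]: "height \<phi> \<in> borel_measurable borel"
  unfolding height_def by (intro borel_measurable_continuous_onI continuous_intros)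

lemma sets_sphere_uniform: "sets sphere_uniform = sets (restrict_space borel (sphere 0 1))"
  and space_sphere_uniform: "space sphere_uniform = sphere 0 1"
  by (simp_all add: sphere_uniform_def sphere_area_def surface_area_def space_restrict_space
      space_scale_measure)

lemma sphere_Collect_in_sets:
  assumes "Measurable.pred borel Q"
  shows "{P \<in> sphere 0 1. Q P} \<in> sets sphere_uniform"
proof -
  have "{P \<in> sphere 0 1. Q P} = sphere 0 1 \<inter> {P \<in> space borel. Q P}" by auto
  then show ?thesis
    using assms unfolding sets_sphere_uniform
    by (subst sets_restrict_space_iff) (auto intro!: sets.Int closed_sphere borel_closed simp: pred_def)
qed

lemma height_spherical: "height \<phi> (spherical u v) = sin u * cos (v - \<phi>)"
  by (simp add: height_def spherical_def cos_diff algebra_simps)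

text \<open>Archimedes' formula: the area is proportional to \<open>1 - h\<close>. In the coordinates used here the cap does
  not lie around a pole but around a point of the equator, and its azimuth range may wrap around the
  cut at \<open>v = 0\<close>; periodicity moves the range to \<open>[-\<pi>, \<pi>)\<close>, centred at the cap.\<close>
lemma emeasure_cap:
  assumes h: "0 < h" "h < 1" and phi: "\<phi> \<in> {0..2 * pi}"
  shows "emeasure sphere_area (cap \<phi> h) = ennreal (2 * pi * (1 - h))"
proof -
  have [measurable]: "cap_slice h \<in> borel_measurable borel"
    unfolding cap_slice_def by measurable
  have "cap \<phi> h \<in> sets sphere_uniform"
    unfolding cap_def by (rule sphere_Collect_in_sets) measurable
  then have "emeasure sphere_area (cap \<phi> h) =
    (\<integral>\<^sup>+v. (\<integral>\<^sup>+u. ennreal (sin u) * indicator {0..pi} u * indicator (cap \<phi> h) (spherical u v) \<partial>lborel)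
      * indicator {0..<2 * pi} v \<partial>lborel)"
    unfolding sets_sphere_uniform by (rule emeasure_sphere_area)
  also have "\<dots> = (\<integral>\<^sup>+v. ennreal (cap_slice h (v - \<phi>)) * indicator {0..<2 * pi} v \<partial>lborel)"
  proof (rule nn_integral_cong)
    fix v
    have "indicator (cap \<phi> h) (spherical u v) = (indicator {u. h < sin u * cos (v - \<phi>)} u :: ennreal)" for u
      using spherical_in_sphere[of u v] by (simp add: indicator_def cap_def height_spherical)
    then show "(\<integral>\<^sup>+u. ennreal (sin u) * indicator {0..pi} u * indicator (cap \<phi> h) (spherical u v) \<partial>lborel)
      * indicator {0..<2 * pi} v = ennreal (cap_slice h (v - \<phi>)) * indicator {0..<2 * pi} v"
      by (simp only: nn_integral_cap_slice[OF h(1)])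
  qed
  also have "\<dots> = (\<integral>\<^sup>+w. ennreal (cap_slice h w) * indicator {- \<phi>..<- \<phi> + 2 * pi} w \<partial>lborel)"
    by (subst nn_integral_real_affine[where c = 1 and t = \<phi>])
      (auto intro!: nn_integral_cong split: split_indicator)
  also have "\<dots> = (\<integral>\<^sup>+w. ennreal (cap_slice h w) * indicator {- pi..<- pi + 2 * pi} w \<partial>lborel)"
  proof (cases "\<phi> \<le> pi")
    case True
    then show ?thesis using phi by (intro nn_integral_periodic) (auto simp: cap_slice_def)
  next
    case False
    then show ?thesis using phi by (intro nn_integral_periodic[symmetric]) (auto simp: cap_slice_def)
  qed
  also have "\<dots> = ennreal (2 * pi * (1 - h))" by (rule nn_integral_cap_slice_period[OF h])
  finally show ?thesis .
qed

section \<open>Probabilities of caps and circles\<close>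

interpretation sphere: prob_space sphere_uniform
  by (rule prob_space_sphere_uniform)

lemma prob_cap:
  assumes "0 < h" "h < 1" "\<phi> \<in> {0..2 * pi}"
  shows "sphere.prob (cap \<phi> h) = (1 - h) / 2"
proof -
  have "emeasure sphere_uniform (cap \<phi> h) = ennreal (1 / (4 * pi)) * ennreal (2 * pi * (1 - h))"
    by (simp only: sphere_uniform_def emeasure_scale_measure emeasure_cap[OF assms])
  also have "\<dots> = ennreal ((1 - h) / 2)"
    using assms by (simp flip: ennreal_mult)
  finally show ?thesis
    using assms by (simp add: measure_def)
qed

text \<open>The area of a cap depends continuously on its height, and the circle lies between the cap of
  height \<open>h\<close> and every larger cap.\<close>
lemma circle_null:
  assumes "0 < h" "h < 1" "\<phi> \<in> {0..2 * pi}"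
  shows "{P \<in> sphere 0 1. height \<phi> P = h} \<in> null_sets sphere_uniform" (is "?C \<in> _")
proof -
  have sets: "?C \<in> sphere.events" "\<And>t. cap \<phi> t \<in> sphere.events"
    unfolding cap_def by (rule sphere_Collect_in_sets; measurable)+
  have bound: "sphere.prob ?C \<le> (h - t) / 2" if "0 < t" "t < h" for t
  proof -
    have "sphere.prob ?C + sphere.prob (cap \<phi> h) = sphere.prob (?C \<union> cap \<phi> h)"
      using sets by (intro sphere.finite_measure_Union[symmetric]) (auto simp: cap_def)
    also have "\<dots> \<le> sphere.prob (cap \<phi> t)"
      using sets that by (intro sphere.finite_measure_mono) (auto simp: cap_def)
    finally show ?thesis using that assms by (simp add: prob_cap diff_divide_distrib)
  qed
  have "sphere.prob ?C \<le> 0"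
  proof (rule ccontr)
    \<comment> \<open>The bound \<open>h / 2\<close> keeps the height \<open>h - m\<close> of the larger cap positive. If the circle had
      positive probability, that cap would exceed the smaller one by only half of \<open>m\<close>.\<close>
    define m where "m = min (h / 2) (sphere.prob ?C)"
    assume "\<not> sphere.prob ?C \<le> 0"
    then have "0 < m" "m \<le> sphere.prob ?C" "m \<le> h / 2" using assms(1) by (auto simp: m_def)
    moreover have "sphere.prob ?C \<le> m / 2"
      using bound[of "h - m"] calculation assms(1) by simp
    ultimately show False by linarith
  qed
  then have "sphere.prob ?C = 0" using measure_nonneg[of sphere_uniform ?C] by linarith
  then show ?thesis using sets by (simp add: null_sets_def sphere.emeasure_eq_measure)
qed

text \<open>Every meridian meets the equator only at \<open>u = \<pi>/2\<close>.\<close>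
lemma equator_null: "{P \<in> sphere 0 1. P$2 = 0} \<in> null_sets sphere_uniform" (is "?E \<in> _")
proof -
  have "(\<lambda>P :: real^3. P$2) \<in> borel_measurable borel"
    by (intro borel_measurable_continuous_onI continuous_intros)
  then have E: "?E \<in> sphere.events"
    by (intro sphere_Collect_in_sets) measurable
  have "(\<integral>\<^sup>+u. ennreal (sin u) * indicator {0..pi} u * indicator ?E (spherical u v) \<partial>lborel) = 0" for v
  proof -
    have "(\<integral>\<^sup>+u. ennreal (sin u) * indicator {0..pi} u * indicator ?E (spherical u v) \<partial>lborel) =
        (\<integral>\<^sup>+u. 0 \<partial>(lborel :: real measure))"
    proof (rule nn_integral_cong_AE, rule AE_mp[OF AE_lborel_singleton[of "pi / 2"]], intro AE_I2 impI)
      fix u :: real assume u: "u \<noteq> pi / 2"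
      have "cos u \<noteq> 0" if "u \<in> {0..pi}"
        using that u cos_inj_pi[of u "pi / 2"] by auto
      then show "ennreal (sin u) * indicator {0..pi} u * indicator ?E (spherical u v) = 0"
        by (auto simp: spherical_def split: split_indicator)
    qed
    then show ?thesis by simp
  qed
  then have "emeasure sphere_area ?E = 0"
    using E unfolding sets_sphere_uniform by (simp add: emeasure_sphere_area)
  then show ?thesis using E by (simp add: null_sets_def sphere_uniform_def)
qed

section \<open>The probability of obtuse and acute shapes\<close>

lemma height_le_1:
  assumes "P \<in> sphere 0 1"
  shows "\<bar>height \<phi> P\<bar> \<le> 1"
proof -
  have "P \<bullet> P = 1" using assms by (simp add: norm_eq_sqrt_inner)
  then have P: "(P$1)\<^sup>2 + (P$2)\<^sup>2 + (P$3)\<^sup>2 = 1"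
    by (simp add: inner_vec_def sum_3 power2_eq_square)
  have "(height \<phi> P)\<^sup>2 + (P$1 * cos \<phi> - P$3 * sin \<phi>)\<^sup>2 = ((P$1)\<^sup>2 + (P$3)\<^sup>2) * ((sin \<phi>)\<^sup>2 + (cos \<phi>)\<^sup>2)"
    unfolding height_def by (simp only: power2_eq_square algebra_simps)
  then have "(height \<phi> P)\<^sup>2 \<le> 1"
    using P zero_le_power2[of "P$1 * cos \<phi> - P$3 * sin \<phi>"] zero_le_power2[of "P$2"]
    unfolding sin_cos_squared_add mult_1_right by linarith
  then show ?thesis by (simp add: abs_square_le_1)
qed

text \<open>The three centres are unit vectors with sum zero, so the heights over them add up to zero; two of
  them above \<open>1/2\<close> would push the third below \<open>-1\<close>. The bound is sharp: neighbouring caps touch at the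
  shapes in which two vertices coincide.\<close>
lemma midpoint_caps_disjoint:
  "disjoint_family_on (\<lambda>\<phi>. cap \<phi> (1 / 2)) midpoint_azimuths"
proof -
  have *: False if "P \<in> sphere 0 1" "\<phi> \<in> midpoint_azimuths" "\<psi> \<in> midpoint_azimuths" "\<phi> \<noteq> \<psi>"
    "1 / 2 < height \<phi> P" "1 / 2 < height \<psi> P" for P \<phi> \<psi>
  proof -
    have "height 0 P + height (2 * pi / 3) P + height (4 * pi / 3) P = 0"
      unfolding height_def trig_thirds by (simp add: algebra_simps)
    moreover have "-1 \<le> height 0 P" "-1 \<le> height (2 * pi / 3) P" "-1 \<le> height (4 * pi / 3) P"
      using height_le_1[OF that(1)] abs_le_D2 by (metis minus_le_iff)+
    ultimately show False
      using that(2-6) unfolding insert_iff empty_iff by (elim disjE FalseE; hypsubst; linarith)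
  qed
  show ?thesis
    unfolding disjoint_family_on_def cap_def using * by blast
qed

theorem theorem1:
  "shape_prob obtuse = 3 / 4 \<and>
   shape_prob acute = 1 - shape_prob obtuse \<and> shape_prob acute = 1 / 4"
proof -
  define U where "U = (\<Union>\<phi>\<in>midpoint_azimuths. cap \<phi> (1 / 2))"
  define E where "E = {P \<in> sphere 0 1 :: (real^3) set. P$2 = 0}"
  define C where "C = (\<Union>\<phi>\<in>midpoint_azimuths. {P \<in> sphere 0 1. height \<phi> P = 1 / 2})"
  have range: "\<phi> \<in> {0..2 * pi}" if "\<phi> \<in> midpoint_azimuths" for \<phi>
    using that by auto (use pi_ge_zero in linarith)+
  have cap_sets: "cap \<phi> h \<in> sphere.events" for \<phi> h
    unfolding cap_def by (rule sphere_Collect_in_sets) measurable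
  then have U: "U \<in> sphere.events" by (simp add: U_def)
  have E: "E \<in> null_sets sphere_uniform"
    unfolding E_def by (rule equator_null)
  have "C \<in> null_sets sphere_uniform"
    unfolding C_def using range by (intro null_sets_UN' circle_null) auto
  with E have EC: "E \<union> C \<in> null_sets sphere_uniform" by auto
  have "sphere.prob U = (\<Sum>\<phi>\<in>midpoint_azimuths. sphere.prob (cap \<phi> (1 / 2)))"
    unfolding U_def using cap_sets midpoint_caps_disjoint
    by (intro sphere.finite_measure_finite_Union) auto
  also have "\<dots> = (\<Sum>\<phi>\<in>midpoint_azimuths. 1 / 4)"
    using range by (intro sum.cong) (auto simp: prob_cap)
  finally have prob_U: "sphere.prob U = 3 / 4" by simp
  have "shape_prob obtuse = sphere.prob (U - E)"
  proof -
    have "shape_point ` {S \<in> shapes. \<forall>q\<in>S. obtuse q} = {x \<in> sphere 0 1. x$2 \<noteq> 0 \<and>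
        (\<exists>\<phi>\<in>midpoint_azimuths. height \<phi> x > 1 / 2)}"
      by (rule shape_point_image) (rule obtuse_iff_height)
    also have "\<dots> = U - E" by (auto simp: U_def E_def cap_def)
    finally show ?thesis by (simp only: shape_prob_def)
  qed
  also have "\<dots> = 3 / 4"
    using prob_U measure_Diff_null_set[OF U E] by simp
  finally have obtuse: "shape_prob obtuse = 3 / 4" .
  have "shape_prob acute = sphere.prob (space sphere_uniform - U - (E \<union> C))"
  proof -
    have "shape_point ` {S \<in> shapes. \<forall>q\<in>S. acute q} = {x \<in> sphere 0 1. x$2 \<noteq> 0 \<and>
        (\<forall>\<phi>\<in>midpoint_azimuths. height \<phi> x < 1 / 2)}"
      by (rule shape_point_image) (rule acute_iff_height)
    also have "\<dots> = space sphere_uniform - U - (E \<union> C)"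
      by (auto simp: U_def E_def C_def cap_def space_sphere_uniform)
    finally show ?thesis by (simp only: shape_prob_def)
  qed
  also have "\<dots> = sphere.prob (space sphere_uniform - U)"
    using U by (intro measure_Diff_null_set EC) auto
  also have "\<dots> = 1 / 4"
    using sphere.prob_compl[OF U] prob_U by simp
  finally show ?thesis using obtuse by simp
qed

end
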